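(* Let $\Omega$ be a bounded domain in $\mathbb{R}^n$, let $F\in(L^2(\Omega))^n$ and $H\in L^2(\Omega)$, let $a\in L^2(\Omega)$ be a positive function, and assume that the primal problem $$(P')\qquad \inf_{u\in H^1_0(\Omega)}\int_\Omega\big(a|Du+F|+Hu\big)\,dx$$ is bounded below. Consider its dual problem $$(D')\qquad \sup\{\langle F,b\rangle: b\in\widetilde{\mathcal{D}}_0,\ |b|\le a\text{ a.e. in }\Omega\}.$$ Then the duality gap is zero and the dual problem $(D')$ has a solution, i.e. there exists a vector field $N\in\widetilde{\mathcal{D}}_0$ with $|N|\le a$ a.e. in $\Omega$ such that $$\inf_{u\in H^1_0(\Omega)}\int_\Omega\big(a|Du+F|+Hu\big)\,dx=\langle F,N\rangle .$$ Moreover, $$\frac{Du+F}{|Du+F|}=N\qquad |Du+F|\text{-a.e. in }\Omega$$ for any minimizer $u$ of $(P')$.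
   Context: $Du$ denotes the gradient of $u$. $\widetilde{\mathcal{D}}_0=\{b\in(L^2(\Omega))^n:\int_\Omega(\nabla u\cdot b+Hu)\,dx=0\text{ for all }u\in H^1_0(\Omega)\}$. $\langle F,b\rangle=\int_\Omega F\cdot b\,dx$. "$|Du+F|$-a.e." means almost everywhere with respect to the measure $|Du+F|$.
   Formalization: The last identity is proved as a(Du+F)/|Du+F| = N, |Du+F|-a.e.; as printed, without the factor a, it fails (n=1, Ω=(0,1), F=1, H=0, a=2: u=0 is a minimizer and N=2, but (Du+F)/|Du+F|=1). For a=1 the two forms agree. *)

theory Defs
  imports "HOL-Analysis.Analysis"
begin

text \<open>Functions on \<open>\<Omega>\<close> are represented by total functions on \<open>real ^ 'n\<close>; their
  values outside \<open>\<Omega>\<close> play no role. The measure on \<open>\<Omega>\<close> is \<^term>\<open>lebesgue_on \<Omega>\<close>.\<close>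

definition bounded_domain :: "'a::euclidean_space set \<Rightarrow> bool" where
  "bounded_domain \<Omega> \<longleftrightarrow> open \<Omega> \<and> connected \<Omega> \<and> \<Omega> \<noteq> {} \<and> bounded \<Omega>"

definition L2 :: "'a::euclidean_space set \<Rightarrow> ('a \<Rightarrow> 'b::euclidean_space) set" where
  "L2 \<Omega> = {f \<in> borel_measurable (lebesgue_on \<Omega>).
            integrable (lebesgue_on \<Omega>) (\<lambda>x. (norm (f x))\<^sup>2)}"

definition partial_deriv :: "'n::finite \<Rightarrow> (real ^ 'n \<Rightarrow> real) \<Rightarrow> real ^ 'n \<Rightarrow> real" where
  "partial_deriv i f x = frechet_derivative f (at x) (axis i 1)"

primrec Ck :: "nat \<Rightarrow> (real ^ 'n::finite \<Rightarrow> real) \<Rightarrow> bool" where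
  "Ck 0 f \<longleftrightarrow> continuous_on UNIV f"
| "Ck (Suc k) f \<longleftrightarrow> f differentiable_on UNIV \<and> (\<forall>i. Ck k (partial_deriv i f))"

text \<open>The space $C_c^\infty(\Omega)$, its elements being extended by zero to the whole space.\<close>

definition test_functions :: "(real ^ 'n::finite) set \<Rightarrow> (real ^ 'n \<Rightarrow> real) set" where
  "test_functions \<Omega> =
     {\<phi>. (\<forall>k. Ck k \<phi>) \<and> compact (closure {x. \<phi> x \<noteq> 0}) \<and> closure {x. \<phi> x \<noteq> 0} \<subseteq> \<Omega>}"

definition has_weak_gradient ::
    "(real ^ 'n::finite) set \<Rightarrow> (real ^ 'n \<Rightarrow> real) \<Rightarrow> (real ^ 'n \<Rightarrow> real ^ 'n) \<Rightarrow> bool" where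
  "has_weak_gradient \<Omega> u G \<longleftrightarrow>
     (\<forall>\<phi>\<in>test_functions \<Omega>. \<forall>i.
        (LINT x|lebesgue_on \<Omega>. u x * partial_deriv i \<phi> x)
          = - (LINT x|lebesgue_on \<Omega>. G x $ i * \<phi> x))"

definition H1 :: "(real ^ 'n::finite) set \<Rightarrow> (real ^ 'n \<Rightarrow> real) set" where
  "H1 \<Omega> = {u \<in> L2 \<Omega>. \<exists>G\<in>L2 \<Omega>. has_weak_gradient \<Omega> u G}"

text \<open>The weak gradient is determined up to null sets of \<open>\<Omega>\<close>; a representative is chosen.
  The value is meaningful for \<open>u\<close> in \<^term>\<open>H1 \<Omega>\<close>.\<close>

definition weak_grad ::
    "(real ^ 'n::finite) set \<Rightarrow> (real ^ 'n \<Rightarrow> real) \<Rightarrow> real ^ 'n \<Rightarrow> real ^ 'n" where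
  "weak_grad \<Omega> u = (SOME G. G \<in> L2 \<Omega> \<and> has_weak_gradient \<Omega> u G)"

definition H1_norm :: "(real ^ 'n::finite) set \<Rightarrow> (real ^ 'n \<Rightarrow> real) \<Rightarrow> real" where
  "H1_norm \<Omega> u =
     sqrt ((LINT x|lebesgue_on \<Omega>. (u x)\<^sup>2) + (LINT x|lebesgue_on \<Omega>. (norm (weak_grad \<Omega> u x))\<^sup>2))"

text \<open>$H^1_0(\Omega)$ is the closure of $C_c^\infty(\Omega)$ in $H^1(\Omega)$.\<close>

definition H10 :: "(real ^ 'n::finite) set \<Rightarrow> (real ^ 'n \<Rightarrow> real) set" where
  "H10 \<Omega> = {u \<in> H1 \<Omega>. \<forall>e>0. \<exists>\<phi>\<in>test_functions \<Omega>. H1_norm \<Omega> (\<lambda>x. u x - \<phi> x) < e}"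

definition pairing ::
    "(real ^ 'n::finite) set \<Rightarrow> (real ^ 'n \<Rightarrow> real ^ 'n) \<Rightarrow> (real ^ 'n \<Rightarrow> real ^ 'n) \<Rightarrow> real" where
  "pairing \<Omega> F b = (LINT x|lebesgue_on \<Omega>. F x \<bullet> b x)"

definition primal_functional ::
    "(real ^ 'n::finite) set \<Rightarrow> (real ^ 'n \<Rightarrow> real) \<Rightarrow> (real ^ 'n \<Rightarrow> real ^ 'n) \<Rightarrow>
     (real ^ 'n \<Rightarrow> real) \<Rightarrow> (real ^ 'n \<Rightarrow> real) \<Rightarrow> real" where
  "primal_functional \<Omega> a F H u =
     (LINT x|lebesgue_on \<Omega>. a x * norm (weak_grad \<Omega> u x + F x) + H x * u x)"

definition D0 ::
    "(real ^ 'n::finite) set \<Rightarrow> (real ^ 'n \<Rightarrow> real) \<Rightarrow> (real ^ 'n \<Rightarrow> real ^ 'n) set" where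
  "D0 \<Omega> H = {b \<in> L2 \<Omega>. \<forall>u\<in>H10 \<Omega>.
     (LINT x|lebesgue_on \<Omega>. weak_grad \<Omega> u x \<bullet> b x + H x * u x) = 0}"

definition dual_feasible ::
    "(real ^ 'n::finite) set \<Rightarrow> (real ^ 'n \<Rightarrow> real) \<Rightarrow> (real ^ 'n \<Rightarrow> real) \<Rightarrow>
     (real ^ 'n \<Rightarrow> real ^ 'n) set" where
  "dual_feasible \<Omega> a H = {b \<in> D0 \<Omega> H. AE x in lebesgue_on \<Omega>. norm (b x) \<le> a x}"

end

theory Submission
  imports Defs "HOL-Real_Asymp.Real_Asymp"
begin

text \<open>
  Write \<open>D u\<close> for the weak gradient, \<open>J u = \<integral> a |D u + F| + H u\<close> for the primal functional and
  \<open>m\<close> for its infimum over $H^1_0$. Weak duality is the pointwise Cauchy--Schwarz inequality: if \<open>b\<close> is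
  dual feasible, then \<open>J u - \<langle>F, b\<rangle> = \<integral> a |D u + F| - (D u + F) \<bullet> b\<close> and the integrand is nonnegative.
  So everything rests on one feasible field \<open>N\<close> with \<open>\<langle>F, N\<rangle> = m\<close>. If \<open>u\<close> is a minimizer, the
  integral above vanishes for \<open>b = N\<close>, hence equality holds in Cauchy--Schwarz almost everywhere, which
  is the asserted alignment of \<open>N\<close> with \<open>D u + F\<close>.

  The field \<open>N\<close> comes from a linear functional. On $L^2$ consider the sublinear functional
  \<open>p f = \<integral> a |f|\<close>, and ask for a linear \<open>l \<le> p\<close> with \<open>l (D u) = - \<integral> H u\<close> and \<open>l F = m\<close>. By the
  definition of \<open>m\<close> and homogeneity, \<open>s m - \<integral> H u \<le> p (D u + s F)\<close> for all \<open>s \<ge> 0\<close>; the case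
  \<open>s = 0\<close> follows from \<open>s > 0\<close> by a limit, since \<open>m\<close> is finite. These inequalities
  say that a convex cone of prescribed lower bounds lies below \<open>p\<close>, and the Hahn--Banach theorem
  \<open>Hahn_Banach_cone\<close> produces \<open>l\<close>. The lower bounds become equalities because the
  gradients form a linear space and \<open>l \<le> p\<close>.

  A linear functional on $L^2$ below \<open>\<integral> a |f|\<close> is integration against a field \<open>N\<close> with
  \<open>|N| \<le> a\<close> (\<open>representation\<close>): on indicator functions it is a signed measure dominated by
  \<open>a dx\<close>, so the Radon--Nikodym theorem applies to each component.

  The cone is only a cone if \<open>u \<mapsto> D u\<close> is linear almost everywhere on the linear space $H^1_0$.
  That requires weak gradients to be unique, which needs a supply of smooth functions
  (\<open>AE_eq_0_if_orthogonal_to_test_functions\<close>), and test functions to have weak gradients, which is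
  integration by parts (\<open>test_function_weak_gradient\<close>).
\<close>

section \<open>Smooth bump functions on boxes\<close>

text \<open>
  The functions \<open>exp (-c/t) / t ^ k\<close>, extended by zero, are closed under differentiation up to linear
  combinations. Products of such functions of the coordinates therefore have derivatives of every
  order; the power of \<open>t\<close> is there to make the family closed.
\<close>

definition flat_exp :: "real \<Rightarrow> nat \<Rightarrow> real \<Rightarrow> real" where
  "flat_exp c k t = (if t > 0 then exp (- c / t) / t ^ k else 0)"

lemma flat_exp_tendsto_0:
  assumes "c > 0"
  shows "((\<lambda>t. flat_exp c k t / t) \<longlongrightarrow> 0) (at 0)"
proof -
  have "((\<lambda>t. exp (- c / t) / t ^ k / t) \<longlongrightarrow> 0) (at_right 0)"
    using assms by real_asymp
  then have "((\<lambda>t. flat_exp c k t / t) \<longlongrightarrow> 0) (at_right 0)"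
    by (rule Lim_transform_eventually)
      (auto simp: eventually_at_filter flat_exp_def)
  moreover have "((\<lambda>t. flat_exp c k t / t) \<longlongrightarrow> 0) (at_left 0)"
    by (rule Lim_transform_eventually[OF tendsto_const])
      (auto simp: eventually_at_filter flat_exp_def)
  ultimately show ?thesis
    by (simp add: filterlim_at_split)
qed

lemma flat_exp_has_derivative:
  assumes "c > 0"
  shows "(flat_exp c k has_real_derivative
           c * flat_exp c (k + 2) t - real k * flat_exp c (k + 1) t) (at t)"
proof (cases t "0::real" rule: linorder_cases)
  case less
  have "((\<lambda>_. 0) has_real_derivative 0) (at t)" by simp
  then have "(flat_exp c k has_real_derivative 0) (at t)"
    by (rule has_field_derivative_transform_within_open[of _ _ _ "{..<0}"])
      (use less in \<open>auto simp: flat_exp_def\<close>)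
  then show ?thesis using less by (simp add: flat_exp_def)
next
  case equal
  have "((\<lambda>h. (flat_exp c k (0 + h) - flat_exp c k 0) / h) \<longlongrightarrow> 0) (at 0)"
    using flat_exp_tendsto_0[OF assms, of k] by (simp add: flat_exp_def)
  then show ?thesis using equal by (simp add: DERIV_def flat_exp_def)
next
  case greater
  have "((\<lambda>t. exp (- c / t) / t ^ k) has_real_derivative
      (exp (- c / t) * (c / t\<^sup>2) * t ^ k - exp (- c / t) * (real k * t ^ (k - 1))) / (t ^ k * t ^ k)) (at t)"
    using greater by (auto intro!: derivative_eq_intros simp: power2_eq_square)
  also have "(exp (- c / t) * (c / t\<^sup>2) * t ^ k - exp (- c / t) * (real k * t ^ (k - 1))) / (t ^ k * t ^ k)
     = c * flat_exp c (k + 2) t - real k * flat_exp c (k + 1) t"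
    using greater by (cases k) (auto simp: flat_exp_def field_simps power2_eq_square)
  finally show ?thesis
    by (rule has_field_derivative_transform_within_open[of _ _ _ "{0<..}"])
      (use greater in \<open>auto simp: flat_exp_def\<close>)
qed

lemma partial_deriv_eqI:
  "(f has_derivative D) (at x) \<Longrightarrow> partial_deriv i f x = D (axis i 1)"
  unfolding partial_deriv_def by (simp add: frechet_derivative_at[symmetric])

lemma partial_deriv_const: "partial_deriv i (\<lambda>x. r) = (\<lambda>x. 0)"
  by (rule ext, rule partial_deriv_eqI[of _ "\<lambda>_. 0"]) simp

lemma partial_deriv_add:
  assumes "f differentiable_on UNIV" "g differentiable_on UNIV"
  shows "partial_deriv i (\<lambda>x. f x + g x) = (\<lambda>x. partial_deriv i f x + partial_deriv i g x)"
proof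
  fix x
  have "f differentiable at x" "g differentiable at x"
    using assms by (auto simp: differentiable_on_def)
  then have "((\<lambda>x. f x + g x) has_derivative
      (\<lambda>h. frechet_derivative f (at x) h + frechet_derivative g (at x) h)) (at x)"
    by (intro has_derivative_add) (simp_all add: frechet_derivative_works)
  from partial_deriv_eqI[OF this] show "partial_deriv i (\<lambda>x. f x + g x) x = partial_deriv i f x + partial_deriv i g x"
    by (simp add: partial_deriv_def)
qed

lemma partial_deriv_mult:
  assumes "f differentiable_on UNIV" "g differentiable_on UNIV"
  shows "partial_deriv i (\<lambda>x. f x * g x) = (\<lambda>x. f x * partial_deriv i g x + partial_deriv i f x * g x)"
proof
  fix x
  have "f differentiable at x" "g differentiable at x"
    using assms by (auto simp: differentiable_on_def)
  then have "((\<lambda>x. f x * g x) has_derivative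
      (\<lambda>h. f x * frechet_derivative g (at x) h + frechet_derivative f (at x) h * g x)) (at x)"
    by (intro has_derivative_mult) (simp_all add: frechet_derivative_works)
  from partial_deriv_eqI[OF this] show "partial_deriv i (\<lambda>x. f x * g x) x = f x * partial_deriv i g x + partial_deriv i f x * g x"
    by (simp add: partial_deriv_def)
qed

lemma partial_deriv_cmult:
  assumes "f differentiable_on UNIV"
  shows "partial_deriv i (\<lambda>x. c * f x) = (\<lambda>x. c * partial_deriv i f x)"
  using partial_deriv_mult[OF differentiable_on_const assms, of i c] by (simp add: partial_deriv_const)

text \<open>
  An algebra of functions that is mapped into itself by all partial derivatives consists of
  $C^\infty$ functions; this one is generated by the flat exponentials of affine functions of a
  single coordinate.
\<close>

inductive_set flat_algebra :: "(real ^ 'n::finite \<Rightarrow> real) set" where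
  const: "(\<lambda>x. r) \<in> flat_algebra"
| flat: "c > 0 \<Longrightarrow> (\<lambda>x. flat_exp c k (s * x $ i + d)) \<in> flat_algebra"
| add: "f \<in> flat_algebra \<Longrightarrow> g \<in> flat_algebra \<Longrightarrow> (\<lambda>x. f x + g x) \<in> flat_algebra"
| mult: "f \<in> flat_algebra \<Longrightarrow> g \<in> flat_algebra \<Longrightarrow> (\<lambda>x. f x * g x) \<in> flat_algebra"

lemma flat_algebra_differentiable:
  fixes f :: "real ^ 'n::finite \<Rightarrow> real"
  assumes "f \<in> flat_algebra"
  shows "f differentiable_on UNIV \<and> (\<forall>i. partial_deriv i f \<in> flat_algebra)"
  using assms
proof induction
  case (const r)
  then show ?case by (simp add: partial_deriv_const flat_algebra.const)
next
  case (flat c k s i d)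
  let ?f = "\<lambda>x::real^'n. flat_exp c k (s * x $ i + d)"
  let ?g = "\<lambda>t. c * flat_exp c (k + 2) t - real k * flat_exp c (k + 1) t"
  have D: "(?f has_derivative (\<lambda>h. ?g (s * x $ i + d) * (s * h $ i))) (at x)" for x
  proof -
    have "((\<lambda>x::real^'n. s * x $ i + d) has_derivative (\<lambda>h. s * h $ i)) (at x)"
      by (auto intro!: derivative_eq_intros bounded_linear_imp_has_derivative[OF bounded_linear_vec_nth])
    from has_derivative_compose[OF this flat_exp_has_derivative[OF flat, unfolded has_field_derivative_def]]
    show ?thesis .
  qed
  have "partial_deriv j ?f \<in> flat_algebra" for j
  proof -
    have "partial_deriv j ?f = (\<lambda>x. ((s * axis j 1 $ i) * c) * flat_exp c (k + 2) (s * x $ i + d)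
        + (- (s * axis j 1 $ i) * real k) * flat_exp c (k + 1) (s * x $ i + d))"
      by (rule ext, subst partial_deriv_eqI[OF D]) (simp add: algebra_simps)
    then show ?thesis
      by (simp only:) (intro flat_algebra.intros flat)
  qed
  moreover have "?f differentiable_on UNIV"
    using D by (auto simp: differentiable_on_def differentiable_def)
  ultimately show ?case by blast
next
  case (add f g)
  then show ?case by (simp add: partial_deriv_add flat_algebra.add)
next
  case (mult f g)
  then show ?case by (simp add: partial_deriv_mult flat_algebra.add flat_algebra.mult)
qed

lemma flat_algebra_Ck: "f \<in> flat_algebra \<Longrightarrow> Ck k f"
proof (induction k arbitrary: f)
  case 0
  then show ?case
    using flat_algebra_differentiable by (auto intro: differentiable_imp_continuous_on)
next
  case (Suc k)
  then show ?case using flat_algebra_differentiable by auto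
qed

lemma flat_algebra_prod:
  "finite I \<Longrightarrow> (\<And>i. i \<in> I \<Longrightarrow> f i \<in> flat_algebra) \<Longrightarrow> (\<lambda>x. \<Prod>i\<in>I. f i x) \<in> flat_algebra"
  by (induction I rule: finite_induct) (auto intro: flat_algebra.intros)

text \<open>
  A bump that is positive exactly on the open box. As \<open>c\<close> tends to zero it increases to the
  indicator function of the box.
\<close>

definition box_bump :: "real \<Rightarrow> real ^ 'n \<Rightarrow> real ^ 'n \<Rightarrow> real ^ 'n \<Rightarrow> real" where
  "box_bump c l u x = (\<Prod>i\<in>UNIV. flat_exp c 0 (x $ i - l $ i) * flat_exp c 0 (u $ i - x $ i))"

lemma box_bump_nonzero_iff: "box_bump c l u x \<noteq> 0 \<longleftrightarrow> x \<in> box l u"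
  by (auto simp: box_bump_def flat_exp_def mem_box_cart)

lemma box_bump_bounds: 
  assumes "c > 0" shows "0 \<le> box_bump c l u x" "box_bump c l u x \<le> 1"
proof -
  have *: "0 \<le> flat_exp c 0 t \<and> flat_exp c 0 t \<le> 1" for t
    using assms by (auto simp: flat_exp_def)
  show "0 \<le> box_bump c l u x" unfolding box_bump_def using * by (intro prod_nonneg) auto
  show "box_bump c l u x \<le> 1" unfolding box_bump_def using * 
    by (intro prod_le_1) (auto intro: mult_le_one)
qed

lemma box_bump_test_function:
  assumes "c > 0" "cbox l u \<subseteq> \<Omega>"
  shows "box_bump c l u \<in> test_functions \<Omega>"
proof -
  have "(\<lambda>x. \<Prod>i\<in>UNIV. flat_exp c 0 (1 * x $ i + - l $ i) * flat_exp c 0 ((-1) * x $ i + u $ i))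
      \<in> flat_algebra"
    by (intro flat_algebra_prod flat_algebra.mult flat_algebra.flat assms) auto
  then have "box_bump c l u \<in> flat_algebra"
    unfolding box_bump_def [abs_def] by simp
  moreover have cl: "closure {x. box_bump c l u x \<noteq> 0} \<subseteq> cbox l u"
    unfolding box_bump_nonzero_iff by (intro closure_minimal) (auto simp: box_subset_cbox closed_cbox)
  then have "compact (closure {x. box_bump c l u x \<noteq> 0})"
    using compact_cbox compact_closure bounded_subset[OF bounded_cbox] 
    by (metis (no_types, lifting) closure_subset subset_trans compact_eq_bounded_closed closed_closure)
  ultimately show ?thesis
    using cl assms by (auto simp: test_functions_def flat_algebra_Ck)
qed

lemma box_bump_tendsto:
  fixes l u x :: "real ^ 'n::finite"
  shows
  "(\<lambda>k. box_bump (inverse (real (Suc k))) l u x) \<longlonglongrightarrow> indicator (box l u) x"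
proof (cases "x \<in> box l u")
  case True
  then have pos: "x $ i - l $ i > 0" "u $ i - x $ i > 0" for i by (auto simp: mem_box_cart)
  have *: "(\<lambda>k. flat_exp (inverse (real (Suc k))) 0 t) \<longlonglongrightarrow> 1" if "t > 0" for t
    using that unfolding flat_exp_def by simp real_asymp
  have "(\<lambda>k. box_bump (inverse (real (Suc k))) l u x) \<longlonglongrightarrow> (\<Prod>i\<in>(UNIV::'n set). 1 * 1)"
    unfolding box_bump_def by (intro tendsto_prod tendsto_mult * pos)
  then show ?thesis using True by simp
next
  case False
  then show ?thesis using box_bump_nonzero_iff[of _ l u x] by (simp add: tendsto_eventually)
qed

section \<open>Square-integrable functions\<close>

lemma L2_norm_mult_integrable:
  assumes "f \<in> L2 \<Omega>" "g \<in> L2 \<Omega>"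
  shows "integrable (lebesgue_on \<Omega>) (\<lambda>x. norm (f x) * norm (g x))"
proof (rule Bochner_Integration.integrable_bound)
  show "integrable (lebesgue_on \<Omega>) (\<lambda>x. (norm (f x))\<^sup>2 + (norm (g x))\<^sup>2)"
    using assms by (auto simp: L2_def)
  show "(\<lambda>x. norm (f x) * norm (g x)) \<in> borel_measurable (lebesgue_on \<Omega>)"
    using assms by (auto simp: L2_def)
  have "norm (f x) * norm (g x) \<le> (norm (f x))\<^sup>2 + (norm (g x))\<^sup>2" for x
    using sum_squares_bound[of "norm (f x)" "norm (g x)"] 
      mult_nonneg_nonneg[OF norm_ge_zero[of "f x"] norm_ge_zero[of "g x"]] by linarith
  then show "AE x in lebesgue_on \<Omega>. norm (norm (f x) * norm (g x)) \<le> norm ((norm (f x))\<^sup>2 + (norm (g x))\<^sup>2)"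
    by simp
qed

lemma L2_inner_integrable:
  assumes "f \<in> L2 \<Omega>" "g \<in> L2 \<Omega>"
  shows "integrable (lebesgue_on \<Omega>) (\<lambda>x. f x \<bullet> g x)"
  by (rule Bochner_Integration.integrable_bound[OF L2_norm_mult_integrable[OF assms]])
    (use assms in \<open>auto simp: L2_def Cauchy_Schwarz_ineq2\<close>)

lemma L2_mult_integrable:
  fixes f g :: "_ \<Rightarrow> real"
  assumes "f \<in> L2 \<Omega>" "g \<in> L2 \<Omega>"
  shows "integrable (lebesgue_on \<Omega>) (\<lambda>x. f x * g x)"
  using L2_inner_integrable[OF assms] by (simp add: mult.commute)

lemma L2_norm: "f \<in> L2 \<Omega> \<Longrightarrow> (\<lambda>x. norm (f x)) \<in> L2 \<Omega>"
  by (auto simp: L2_def)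

lemma L2_bound:
  assumes "g \<in> L2 \<Omega>" "f \<in> borel_measurable (lebesgue_on \<Omega>)"
    "AE x in lebesgue_on \<Omega>. norm (f x) \<le> norm (g x)"
  shows "f \<in> L2 \<Omega>"
proof -
  have "integrable (lebesgue_on \<Omega>) (\<lambda>x. (norm (f x))\<^sup>2)"
    by (rule Bochner_Integration.integrable_bound[of _ "\<lambda>x. (norm (g x))\<^sup>2"])
      (use assms in \<open>auto simp: L2_def elim!: eventually_mono intro!: power_mono\<close>)
  then show ?thesis using assms by (simp add: L2_def)
qed

lemma norm_lincomb_square_le:
  fixes u v :: "'a::real_normed_vector"
  shows "(norm (c *\<^sub>R u + d *\<^sub>R v))\<^sup>2 \<le> 2 * c\<^sup>2 * (norm u)\<^sup>2 + 2 * d\<^sup>2 * (norm v)\<^sup>2"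
proof -
  have "(norm (c *\<^sub>R u + d *\<^sub>R v))\<^sup>2 \<le> (\<bar>c\<bar> * norm u + \<bar>d\<bar> * norm v)\<^sup>2"
    by (intro power_mono order_trans[OF norm_triangle_ineq]) auto
  also have "\<dots> \<le> 2 * (\<bar>c\<bar> * norm u)\<^sup>2 + 2 * (\<bar>d\<bar> * norm v)\<^sup>2"
    using sum_squares_bound[of "\<bar>c\<bar> * norm u" "\<bar>d\<bar> * norm v"] by (simp add: power2_sum)
  finally show ?thesis by (simp add: power_mult_distrib)
qed

lemma L2_lincomb:
  assumes "f \<in> L2 \<Omega>" "g \<in> L2 \<Omega>"
  shows "(\<lambda>x. c *\<^sub>R f x + d *\<^sub>R g x) \<in> L2 \<Omega>"
proof -
  have "integrable (lebesgue_on \<Omega>) (\<lambda>x. (norm (c *\<^sub>R f x + d *\<^sub>R g x))\<^sup>2)"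
    by (rule Bochner_Integration.integrable_bound[of _ "\<lambda>x. 2 * c\<^sup>2 * (norm (f x))\<^sup>2 + 2 * d\<^sup>2 * (norm (g x))\<^sup>2"])
      (use assms in \<open>auto simp: L2_def norm_lincomb_square_le\<close>)
  then show ?thesis using assms by (auto simp: L2_def)
qed

lemma L2_add: "f \<in> L2 \<Omega> \<Longrightarrow> g \<in> L2 \<Omega> \<Longrightarrow> (\<lambda>x. f x + g x) \<in> L2 \<Omega>"
  using L2_lincomb[of f \<Omega> g 1 1] by simp

lemma L2_scaleR: "f \<in> L2 \<Omega> \<Longrightarrow> (\<lambda>x. c *\<^sub>R f x) \<in> L2 \<Omega>"
  using L2_lincomb[of f \<Omega> f c 0] by simp

lemma L2_nth: "G \<in> L2 \<Omega> \<Longrightarrow> (\<lambda>x. G x $ i) \<in> L2 \<Omega>"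
  by (rule L2_bound[of G]) (auto simp: L2_def 
      intro!: borel_measurable_continuous_on[where f="\<lambda>v. v $ i"] continuous_intros Finite_Cartesian_Product.norm_nth_le always_eventually)

lemma L2_integral_square_lincomb_le:
  assumes "f \<in> L2 \<Omega>" "g \<in> L2 \<Omega>" "k \<in> L2 \<Omega>"
    and "AE x in lebesgue_on \<Omega>. k x = c *\<^sub>R f x + d *\<^sub>R g x"
  shows "(LINT x|lebesgue_on \<Omega>. (norm (k x))\<^sup>2)
      \<le> 2 * c\<^sup>2 * (LINT x|lebesgue_on \<Omega>. (norm (f x))\<^sup>2) + 2 * d\<^sup>2 * (LINT x|lebesgue_on \<Omega>. (norm (g x))\<^sup>2)"
proof -
  have int: "integrable (lebesgue_on \<Omega>) (\<lambda>x. (norm (f x))\<^sup>2)" "integrable (lebesgue_on \<Omega>) (\<lambda>x. (norm (g x))\<^sup>2)"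
    "integrable (lebesgue_on \<Omega>) (\<lambda>x. (norm (k x))\<^sup>2)"
    using assms by (auto simp: L2_def)
  have "(LINT x|lebesgue_on \<Omega>. (norm (k x))\<^sup>2)
      \<le> (LINT x|lebesgue_on \<Omega>. 2 * c\<^sup>2 * (norm (f x))\<^sup>2 + 2 * d\<^sup>2 * (norm (g x))\<^sup>2)"
  proof (rule integral_mono_AE[OF int(3)])
    show "integrable (lebesgue_on \<Omega>) (\<lambda>x. 2 * c\<^sup>2 * (norm (f x))\<^sup>2 + 2 * d\<^sup>2 * (norm (g x))\<^sup>2)"
      using int by simp
    show "AE x in lebesgue_on \<Omega>. (norm (k x))\<^sup>2 \<le> 2 * c\<^sup>2 * (norm (f x))\<^sup>2 + 2 * d\<^sup>2 * (norm (g x))\<^sup>2"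
      using assms(4) by eventually_elim (simp add: norm_lincomb_square_le)
  qed
  then show ?thesis using int by simp
qed

section \<open>Integration by parts\<close>

lemma integrable_continuous_compact_support:
  fixes k :: "'a::euclidean_space \<Rightarrow> 'b::{banach, second_countable_topology}"
  assumes "continuous_on UNIV k" "compact K" "\<And>x. x \<notin> K \<Longrightarrow> k x = 0"
  shows "integrable lborel k"
proof -
  have "integrable lborel (\<lambda>x. indicator K x *\<^sub>R k x)"
    using assms by (intro borel_integrable_compact) (auto intro: continuous_on_subset)
  also have "(\<lambda>x. indicator K x *\<^sub>R k x) = k"
    using assms(3) by (auto simp: indicator_def)
  finally show ?thesis .
qed

lemma continuous_compact_support_L2:
  fixes k :: "'a::euclidean_space \<Rightarrow> 'b::euclidean_space"
  assumes "continuous_on UNIV k" "compact K" "\<And>x. x \<notin> K \<Longrightarrow> k x = 0" "open \<Omega>"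
  shows "k \<in> L2 \<Omega>"
proof -
  have "k \<in> borel_measurable lborel"
    using assms(1) by (simp add: borel_measurable_continuous_onI)
  then have "k \<in> borel_measurable (lebesgue_on \<Omega>)"
    by (intro measurable_restrict_space1 measurable_completion)
  moreover have "integrable lborel (\<lambda>x. (norm (k x))\<^sup>2)"
    by (rule integrable_continuous_compact_support[OF _ assms(2)])
      (use assms in \<open>auto intro!: continuous_intros\<close>)
  then have "integrable lebesgue (\<lambda>x. (norm (k x))\<^sup>2)"
    by (simp add: integrable_completion)
  then have "integrable (lebesgue_on \<Omega>) (\<lambda>x. (norm (k x))\<^sup>2)"
    using assms(4) integrable_mult_indicator[of \<Omega> lebesgue "\<lambda>x. (norm (k x))\<^sup>2"]
    by (subst integrable_restrict_space) auto
  ultimately show ?thesis by (simp add: L2_def)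
qed

lemma integral_lebesgue_on_eq_lborel:
  fixes k :: "'a::euclidean_space \<Rightarrow> real"
  assumes "continuous_on UNIV k" "\<And>x. x \<notin> \<Omega> \<Longrightarrow> k x = 0" "open \<Omega>"
  shows "integral\<^sup>L (lebesgue_on \<Omega>) k = integral\<^sup>L lborel k"
proof -
  have "integral\<^sup>L (lebesgue_on \<Omega>) k = (LINT x|lebesgue. indicator \<Omega> x *\<^sub>R k x)"
    using assms(3) by (subst integral_restrict_space) auto
  also have "(\<lambda>x. indicator \<Omega> x *\<^sub>R k x) = k"
    using assms(2) by (auto simp: indicator_def fun_eq_iff)
  also have "integral\<^sup>L lebesgue k = integral\<^sup>L lborel k"
    using assms(1) by (intro integral_completion) (simp add: borel_measurable_continuous_onI)
  finally show ?thesis .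
qed

lemma integral_translate_lborel:
  fixes f :: "'a::euclidean_space \<Rightarrow> real"
  assumes "f \<in> borel_measurable borel"
  shows "(LINT x|lborel. f (x + v)) = integral\<^sup>L lborel f"
proof -
  have "integral\<^sup>L lborel f = integral\<^sup>L (distr lborel borel ((+) v)) f"
    by (simp add: lborel_distr_plus)
  also have "\<dots> = (LINT x|lborel. f (v + x))"
    using assms by (subst integral_distr) auto
  finally show ?thesis by (simp add: add.commute)
qed

lemma partial_deriv_zero_outside:
  assumes "closed K" "\<And>x. x \<notin> K \<Longrightarrow> f x = 0" "x \<notin> K"
  shows "partial_deriv i f x = 0"
proof -
  have "((\<lambda>_. 0) has_derivative (\<lambda>_. 0)) (at x)" by simp
  then have "(f has_derivative (\<lambda>_. 0)) (at x)"
    by (rule has_derivative_transform_within_open[of _ _ _ _ "- K"]) (use assms in auto)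
  from partial_deriv_eqI[OF this] show ?thesis by simp
qed

lemma has_real_derivative_along_axis:
  assumes "f differentiable_on UNIV"
  shows "((\<lambda>t. f (x + t *\<^sub>R axis i 1)) has_real_derivative partial_deriv i f (x + t *\<^sub>R axis i 1)) (at t)"
proof -
  let ?y = "x + t *\<^sub>R axis i 1"
  have f: "(f has_derivative frechet_derivative f (at ?y)) (at ?y)"
    using assms by (simp add: differentiable_on_def frechet_derivative_works[symmetric])
  have "((\<lambda>t. x + t *\<^sub>R axis i 1) has_derivative (\<lambda>h. h *\<^sub>R axis i 1)) (at t)"
    by (auto intro!: derivative_eq_intros)
  from has_derivative_compose[OF this f]
  have "((\<lambda>t. f (x + t *\<^sub>R axis i 1)) has_derivative (\<lambda>h. frechet_derivative f (at ?y) (h *\<^sub>R axis i 1))) (at t)" .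
  moreover have "frechet_derivative f (at ?y) (h *\<^sub>R axis i 1) = partial_deriv i f ?y * h" for h
    using linear_cmul[OF has_derivative_linear[OF f], of h "axis i 1"] by (simp add: partial_deriv_def)
  ultimately show ?thesis by (simp add: has_field_derivative_def)
qed

text \<open>
  By translation invariance of Lebesgue measure, the integral of every difference quotient of \<open>f\<close>
  vanishes. The quotients converge to the partial derivative and, by the mean value theorem,
  are bounded by its maximum on a fixed ball, so dominated convergence gives the claim.
\<close>

lemma integral_partial_deriv_eq_0:
  fixes f :: "real ^ 'n::finite \<Rightarrow> real"
  assumes diff: "f differentiable_on UNIV" and cont: "continuous_on UNIV (partial_deriv i f)"
    and K: "compact K" "\<And>x. x \<notin> K \<Longrightarrow> f x = 0"
  shows "integral\<^sup>L lborel (partial_deriv i f) = 0"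
proof -
  let ?e = "axis i 1 :: real ^ 'n"
  define h where "h k = inverse (real (Suc k))" for k
  define q where "q k x = (f (x + h k *\<^sub>R ?e) - f x) / h k" for k x
  have h: "0 < h k" "h k \<le> 1" for k by (auto simp: h_def inverse_le_1_iff)
  have cf: "continuous_on UNIV f" using diff by (rule differentiable_imp_continuous_on)
  then have mf: "f \<in> borel_measurable borel" by (rule borel_measurable_continuous_onI)
  have Z: "partial_deriv i f x = 0" if "x \<notin> K" for x
    using partial_deriv_zero_outside[OF compact_imp_closed[OF K(1)] K(2) that] .
  obtain B where B: "\<And>x. x \<in> K \<Longrightarrow> \<bar>partial_deriv i f x\<bar> \<le> B" "B > 0"
  proof -
    have "bounded (partial_deriv i f ` K)"
      using compact_continuous_image[OF continuous_on_subset[OF cont] K(1)] by (auto dest: compact_imp_bounded)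
    then show ?thesis using that by (auto simp: bounded_pos)
  qed
  then have B': "\<bar>partial_deriv i f x\<bar> \<le> B" for x using Z by (cases "x \<in> K") auto
  obtain R where R: "\<And>x. x \<in> K \<Longrightarrow> norm x \<le> R"
    using compact_imp_bounded[OF K(1)] by (auto simp: bounded_iff)
  have D: "((\<lambda>t. f (x + t *\<^sub>R ?e)) has_real_derivative partial_deriv i f (x + t *\<^sub>R ?e)) (at t)" for x t
    by (rule has_real_derivative_along_axis[OF diff])
  \<comment> \<open>Enlarging the radius by \<open>1\<close> accounts for the shift by \<open>h k \<le> 1\<close>.\<close>
  have q_bound: "\<bar>q k x\<bar> \<le> B * indicator (cball 0 (R + 1)) x" for k x
  proof (cases "x \<in> cball 0 (R + 1)")
    case True
    obtain z where "f (x + h k *\<^sub>R ?e) - f (x + 0 *\<^sub>R ?e) = (h k - 0) * partial_deriv i f (x + z *\<^sub>R ?e)"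
      using MVT2[OF h(1)[of k], of "\<lambda>t. f (x + t *\<^sub>R ?e)" "\<lambda>t. partial_deriv i f (x + t *\<^sub>R ?e)"] D by blast
    then have "q k x = partial_deriv i f (x + z *\<^sub>R ?e)"
      using h(1)[of k] by (simp add: q_def)
    then show ?thesis using True B' by simp
  next
    case False
    then have n: "norm x > R + 1" by simp
    then have "x \<notin> K" using R[of x] by auto
    moreover have "norm x \<le> norm (x + h k *\<^sub>R ?e) + h k"
      using norm_triangle_ineq4[of "x + h k *\<^sub>R ?e" "h k *\<^sub>R ?e"] h(1)[of k] by simp
    then have "x + h k *\<^sub>R ?e \<notin> K" using R[of "x + h k *\<^sub>R ?e"] n h(2)[of k] by auto
    ultimately show ?thesis using K(2) False by (simp add: q_def)
  qed
  have lim: "(\<lambda>k. q k x) \<longlonglongrightarrow> partial_deriv i f x" for x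
  proof -
    have "((\<lambda>t. (f (x + t *\<^sub>R ?e) - f x) / t) \<longlongrightarrow> partial_deriv i f x) (at 0)"
      using D[of x 0] by (simp add: DERIV_def)
    moreover have "filterlim h (at 0) sequentially"
      unfolding filterlim_at
    proof
      show "\<forall>\<^sub>F k in sequentially. h k \<in> UNIV \<and> h k \<noteq> 0"
        using h(1) by (intro always_eventually) (auto simp: less_imp_neq[symmetric])
      show "h \<longlonglongrightarrow> 0" using LIMSEQ_inverse_real_of_nat unfolding h_def [abs_def] .
    qed
    ultimately show ?thesis unfolding q_def by (rule filterlim_compose)
  qed
  have mq: "q k \<in> borel_measurable lborel" for k
    unfolding q_def using mf by simp
  have intf: "integrable lborel f"
    by (rule integrable_continuous_compact_support[OF cf K])
  have "integral\<^sup>L lborel (q k) = 0" for k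
  proof -
    have "integrable lborel (\<lambda>x. f (x + h k *\<^sub>R ?e))"
      by (rule integrable_continuous_compact_support[of _ "(\<lambda>y. - (h k *\<^sub>R ?e) + y) ` K"])
        (use K(1) in \<open>auto intro!: compact_continuous_image continuous_on_compose2[OF cf] continuous_intros K(2)
          simp: image_iff dest!: bspec[of _ _ "_ + h k *\<^sub>R ?e"]\<close>)
    then have "integral\<^sup>L lborel (q k) = ((LINT x|lborel. f (x + h k *\<^sub>R ?e)) - integral\<^sup>L lborel f) / h k"
      unfolding q_def using intf by simp
    then show ?thesis by (simp add: integral_translate_lborel[OF mf])
  qed
  moreover have "(\<lambda>k. integral\<^sup>L lborel (q k)) \<longlonglongrightarrow> integral\<^sup>L lborel (partial_deriv i f)"
  proof (rule integral_dominated_convergence)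
    show "integrable lborel (\<lambda>x. B * indicator (cball 0 (R + 1)) x)"
      by (intro integrable_mult_right integrable_real_indicator) (auto simp: emeasure_lborel_cball_finite[unfolded infinity_ennreal_def])
  qed (use q_bound lim mq cont in \<open>auto simp: borel_measurable_continuous_onI\<close>)
  ultimately show ?thesis by (simp add: LIMSEQ_const_iff)
qed

section \<open>Functions orthogonal to all test functions\<close>

lemma box_translate_subset:
  fixes x :: "'a::euclidean_space"
  assumes "open \<Omega>" "x \<in> \<Omega>"
  obtains d where "d > 0" "\<And>h. 0 < h \<Longrightarrow> h < d \<Longrightarrow> cbox x (x + h *\<^sub>R One) \<subseteq> \<Omega>"
proof -
  obtain e where e: "e > 0" "ball x e \<subseteq> \<Omega>" using assms by (auto simp: open_contains_ball)
  have "cbox x (x + h *\<^sub>R One) \<subseteq> \<Omega>" if h: "0 < h" "h < e / DIM('a)" for h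
  proof
    fix y assume y: "y \<in> cbox x (x + h *\<^sub>R One)"
    have "norm (y - x) \<le> (\<Sum>b\<in>Basis. \<bar>(y - x) \<bullet> b\<bar>)" by (rule norm_le_l1)
    also have "\<dots> \<le> (\<Sum>b\<in>(Basis::'a set). h)"
      using y by (intro sum_mono) (auto simp: mem_box inner_diff_left inner_add_left)
    also have "\<dots> < e" using h by (simp add: field_simps)
    finally show "y \<in> \<Omega>" using e(2) by (auto simp: dist_norm norm_minus_commute)
  qed
  moreover have "e / DIM('a) > 0" using e by simp
  ultimately show ?thesis using that by blast
qed

text \<open>
  The fundamental lemma of the calculus of variations. Bumps converge to indicators of boxes, so the
  integral of \<open>g\<close> over every box inside \<open>\<Omega>\<close> vanishes; by Lebesgue differentiation \<open>g\<close> is almost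
  everywhere the limit of its averages over small boxes.
\<close>

lemma AE_eq_0_if_orthogonal_to_test_functions:
  fixes g :: "real ^ 'n::finite \<Rightarrow> real"
  assumes "open \<Omega>" and g: "integrable (lebesgue_on \<Omega>) g"
    and orth: "\<And>\<phi>. \<phi> \<in> test_functions \<Omega> \<Longrightarrow> (LINT x|lebesgue_on \<Omega>. g x * \<phi> x) = 0"
  shows "AE x in lebesgue_on \<Omega>. g x = 0"
proof -
  define f where "f x = indicator \<Omega> x *\<^sub>R g x" for x
  have \<Omega>: "\<Omega> \<in> sets lebesgue" using assms(1) by simp
  have f: "integrable lebesgue f" unfolding f_def using g \<Omega> by (subst (asm) integrable_restrict_space) auto
  have fc: "f integrable_on cbox a b" for a b
    using integrable_on_subcbox[OF integrable_on_lebesgue[OF f]] by simp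
  have zero: "integral (cbox l u) f = 0" if sub: "cbox l u \<subseteq> \<Omega>" for l u
  proof -
    have "(\<lambda>k. LINT x|lebesgue_on \<Omega>. g x * box_bump (inverse (real (Suc k))) l u x)
         \<longlonglongrightarrow> (LINT x|lebesgue_on \<Omega>. g x * indicator (box l u) x)"
    proof (rule integral_dominated_convergence[where w = "\<lambda>x. norm (g x)"])
      show "(\<lambda>x. g x * box_bump (inverse (real (Suc k))) l u x) \<in> borel_measurable (lebesgue_on \<Omega>)" for k
      proof -
        have "box_bump (inverse (real (Suc k))) l u \<in> test_functions \<Omega>"
          by (intro box_bump_test_function sub) simp
        then have "continuous_on UNIV (box_bump (inverse (real (Suc k))) l u)"
          unfolding test_functions_def by (metis (mono_tags, lifting) mem_Collect_eq Ck.simps(1))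
        then have "box_bump (inverse (real (Suc k))) l u \<in> borel_measurable (lebesgue_on \<Omega>)"
          by (intro measurable_restrict_space1 measurable_completion) (simp add: borel_measurable_continuous_onI)
        then show ?thesis using g by auto
      qed
      show "(\<lambda>x. g x * indicator (box l u) x) \<in> borel_measurable (lebesgue_on \<Omega>)"
        using g \<Omega> by (intro borel_measurable_times borel_measurable_indicator)
           (auto simp: sets_restrict_space_iff intro!: image_eqI[of _ _ "box l u"] order_trans[OF box_subset_cbox sub])
      show "AE x in lebesgue_on \<Omega>. norm (g x * box_bump (inverse (real (Suc k))) l u x) \<le> norm (g x)" for k
        using box_bump_bounds[of "inverse (real (Suc k))" l u] 
        by (auto simp: abs_mult intro!: mult_left_le)
    qed (use g box_bump_tendsto in \<open>auto intro!: tendsto_intros always_eventually\<close>)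
    moreover have "(LINT x|lebesgue_on \<Omega>. g x * box_bump (inverse (real (Suc k))) l u x) = 0" for k
      by (intro orth box_bump_test_function sub) simp
    ultimately have "0 = (LINT x|lebesgue_on \<Omega>. g x * indicator (box l u) x)"
      by (simp add: LIMSEQ_const_iff)
    also have "\<dots> = (LINT x|lebesgue. indicator (box l u) x *\<^sub>R f x)"
      using \<Omega> by (subst integral_restrict_space) (auto simp: f_def mult_ac)
    also have "\<dots> = (LINT x|lebesgue_on (box l u). f x)"
      by (subst integral_restrict_space) auto
    also have "\<dots> = integral (box l u) f"
      by (rule lebesgue_integral_eq_integral)
        (use integrable_mult_indicator[OF _ f, of "box l u"] in \<open>auto simp: integrable_restrict_space\<close>)
    finally show ?thesis by (simp add: integral_open_interval)
  qed
  obtain N where N: "negligible N"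
    and *: "\<And>x e. \<lbrakk>x \<notin> N; 0 < e\<rbrakk> \<Longrightarrow> \<exists>d>0. \<forall>h. 0 < h \<and> h < d \<longrightarrow>
         norm (integral (cbox x (x + h *\<^sub>R One)) f /\<^sub>R h ^ DIM(real ^ 'n) - f x) < e"
    using integrable_ccontinuous_explicit[of f] fc by blast
  have "g x = 0" if x: "x \<notin> N" "x \<in> \<Omega>" for x
  proof (rule ccontr)
    assume "g x \<noteq> 0"
    then obtain d where d: "d > 0" and dd: "\<And>h. 0 < h \<Longrightarrow> h < d \<Longrightarrow>
         norm (integral (cbox x (x + h *\<^sub>R One)) f /\<^sub>R h ^ DIM(real ^ 'n) - f x) < norm (g x)"
      using *[OF x(1), of "norm (g x)"] by auto
    obtain d' where d': "d' > 0" "\<And>h. 0 < h \<Longrightarrow> h < d' \<Longrightarrow> cbox x (x + h *\<^sub>R One) \<subseteq> \<Omega>"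
      using box_translate_subset[OF assms(1) x(2)] by blast
    define h where "h = min d d' / 2"
    have h: "0 < h" "h < d" "h < d'" using d d' by (auto simp: h_def)
    show False using dd[OF h(1,2)] zero[OF d'(2)[OF h(1,3)]] x(2) by (simp add: f_def)
  qed
  moreover have "AE x in lebesgue. x \<notin> N"
    using N by (simp add: negligible_iff_null_sets AE_not_in)
  ultimately show ?thesis
    using \<Omega> by (subst AE_restrict_space_iff) (auto elim!: eventually_mono)
qed

section \<open>Weak gradients and the space $H^1_0$\<close>

definition classical_grad :: "(real ^ 'n::finite \<Rightarrow> real) \<Rightarrow> real ^ 'n \<Rightarrow> real ^ 'n" where
  "classical_grad f x = (\<chi> i. partial_deriv i f x)"

lemma test_function_Ck: "\<phi> \<in> test_functions \<Omega> \<Longrightarrow> Ck k \<phi>"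
  by (simp add: test_functions_def)

lemma test_function_differentiable: "\<phi> \<in> test_functions \<Omega> \<Longrightarrow> \<phi> differentiable_on UNIV"
  using test_function_Ck[of \<phi> \<Omega> "Suc 0"] by simp

lemma test_function_continuous: "\<phi> \<in> test_functions \<Omega> \<Longrightarrow> continuous_on UNIV \<phi>"
  using test_function_Ck[of \<phi> \<Omega> 0] by simp

lemma test_function_partial_continuous:
  "\<phi> \<in> test_functions \<Omega> \<Longrightarrow> continuous_on UNIV (partial_deriv i \<phi>)"
  using test_function_Ck[of \<phi> \<Omega> "Suc 0"] by simp

lemma test_function_support:
  assumes "\<phi> \<in> test_functions \<Omega>"
  obtains K where "compact K" "K \<subseteq> \<Omega>" "\<And>x. x \<notin> K \<Longrightarrow> \<phi> x = 0" "\<And>x i. x \<notin> K \<Longrightarrow> partial_deriv i \<phi> x = 0"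
proof
  let ?K = "closure {x. \<phi> x \<noteq> 0}"
  show "compact ?K" "?K \<subseteq> \<Omega>" using assms by (auto simp: test_functions_def)
  show *: "\<phi> x = 0" if "x \<notin> ?K" for x using that closure_subset[of "{x. \<phi> x \<noteq> 0}"] by auto
  show "partial_deriv i \<phi> x = 0" if "x \<notin> ?K" for x i
    by (rule partial_deriv_zero_outside[OF closed_closure * that])
qed

lemma test_function_L2:
  assumes "\<phi> \<in> test_functions \<Omega>" "open \<Omega>"
  shows "\<phi> \<in> L2 \<Omega>" "partial_deriv i \<phi> \<in> L2 \<Omega>" "classical_grad \<phi> \<in> L2 \<Omega>"
proof -
  obtain K where K: "compact K" "K \<subseteq> \<Omega>" "\<And>x. x \<notin> K \<Longrightarrow> \<phi> x = 0" "\<And>x i. x \<notin> K \<Longrightarrow> partial_deriv i \<phi> x = 0"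
    by (rule test_function_support[OF assms(1)]) blast
  show "\<phi> \<in> L2 \<Omega>"
    by (rule continuous_compact_support_L2[OF test_function_continuous[OF assms(1)] K(1,3) assms(2)])
  show "partial_deriv i \<phi> \<in> L2 \<Omega>"
    by (rule continuous_compact_support_L2[OF test_function_partial_continuous[OF assms(1)] K(1,4) assms(2)])
  have "continuous_on UNIV (classical_grad \<phi>)"
    unfolding classical_grad_def [abs_def]
    by (intro continuous_on_vec_lambda test_function_partial_continuous[OF assms(1)])
  then show "classical_grad \<phi> \<in> L2 \<Omega>"
    by (rule continuous_compact_support_L2[OF _ K(1) _ assms(2)])
      (simp add: classical_grad_def K(4) vec_eq_iff)
qed

text \<open>
  Integration by parts: the product of two test functions is differentiable with compact support,
  so the integral of its partial derivative is zero.
\<close>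

lemma test_function_weak_gradient:
  assumes "\<phi> \<in> test_functions \<Omega>" "open \<Omega>"
  shows "has_weak_gradient \<Omega> \<phi> (classical_grad \<phi>)"
  unfolding has_weak_gradient_def
proof (intro ballI allI)
  fix \<psi> i assume \<psi>: "\<psi> \<in> test_functions \<Omega>"
  obtain K where K: "compact K" "K \<subseteq> \<Omega>" "\<And>x. x \<notin> K \<Longrightarrow> \<phi> x = 0" "\<And>x i. x \<notin> K \<Longrightarrow> partial_deriv i \<phi> x = 0"
    by (rule test_function_support[OF assms(1)]) blast
  note [continuous_intros] = test_function_continuous[OF assms(1)] test_function_continuous[OF \<psi>]
    test_function_partial_continuous[OF assms(1)] test_function_partial_continuous[OF \<psi>]
  note diff = test_function_differentiable[OF assms(1)] test_function_differentiable[OF \<psi>]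
  have eq: "partial_deriv i (\<lambda>x. \<phi> x * \<psi> x) = (\<lambda>x. \<phi> x * partial_deriv i \<psi> x + partial_deriv i \<phi> x * \<psi> x)"
    by (rule partial_deriv_mult[OF diff])
  have cont: "continuous_on UNIV (\<lambda>x. \<phi> x * partial_deriv i \<psi> x)"
     "continuous_on UNIV (\<lambda>x. partial_deriv i \<phi> x * \<psi> x)"
    by (intro continuous_intros)+
  have "integral\<^sup>L lborel (partial_deriv i (\<lambda>x. \<phi> x * \<psi> x)) = 0"
  proof (rule integral_partial_deriv_eq_0[OF _ _ K(1)])
    show "(\<lambda>x. \<phi> x * \<psi> x) differentiable_on UNIV"
      using diff by (rule differentiable_on_mult)
    show "continuous_on UNIV (partial_deriv i (\<lambda>x. \<phi> x * \<psi> x))"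
      unfolding eq by (intro continuous_intros cont)
  qed (simp add: K)
  moreover have "integrable lborel (\<lambda>x. \<phi> x * partial_deriv i \<psi> x)" "integrable lborel (\<lambda>x. partial_deriv i \<phi> x * \<psi> x)"
    by (rule integrable_continuous_compact_support[OF cont(1) K(1)], simp add: K,
        rule integrable_continuous_compact_support[OF cont(2) K(1)], simp add: K)
  ultimately have "(LINT x|lborel. \<phi> x * partial_deriv i \<psi> x) + (LINT x|lborel. partial_deriv i \<phi> x * \<psi> x) = 0"
    unfolding eq by simp
  moreover have van: "\<phi> x = 0 \<and> partial_deriv i \<phi> x = 0" if "x \<notin> \<Omega>" for x
    using K(2-4) that by blast
  have "(LINT x|lebesgue_on \<Omega>. \<phi> x * partial_deriv i \<psi> x) = (LINT x|lborel. \<phi> x * partial_deriv i \<psi> x)"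
     "(LINT x|lebesgue_on \<Omega>. partial_deriv i \<phi> x * \<psi> x) = (LINT x|lborel. partial_deriv i \<phi> x * \<psi> x)"
    by (intro integral_lebesgue_on_eq_lborel cont assms(2), use van in simp)+
  ultimately show "(LINT x|lebesgue_on \<Omega>. \<phi> x * partial_deriv i \<psi> x) =
      - (LINT x|lebesgue_on \<Omega>. classical_grad \<phi> x $ i * \<psi> x)"
    by (simp add: classical_grad_def)
qed

lemma test_function_H1: "\<phi> \<in> test_functions \<Omega> \<Longrightarrow> open \<Omega> \<Longrightarrow> \<phi> \<in> H1 \<Omega>"
  unfolding H1_def by (auto intro: test_function_L2(1,3) test_function_weak_gradient intro!: bexI[of _ "classical_grad \<phi>"])

lemma finite_measure_bounded_open:
  "open \<Omega> \<Longrightarrow> bounded \<Omega> \<Longrightarrow> finite_measure (lebesgue_on \<Omega>)"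
  by (simp add: finite_measure_lebesgue_on bounded_set_imp_lmeasurable)

lemma L2_integrable:
  fixes f :: "_ \<Rightarrow> real"
  assumes "f \<in> L2 \<Omega>" "finite_measure (lebesgue_on \<Omega>)"
  shows "integrable (lebesgue_on \<Omega>) f"
  by (rule finite_measure.square_integrable_imp_integrable[OF assms(2)]) (use assms(1) in \<open>simp_all add: L2_def\<close>)

lemma weak_gradient_unique:
  assumes \<Omega>: "open \<Omega>" "bounded \<Omega>" and G: "G \<in> L2 \<Omega>" "G' \<in> L2 \<Omega>"
    and w: "has_weak_gradient \<Omega> u G" "has_weak_gradient \<Omega> u G'"
  shows "AE x in lebesgue_on \<Omega>. G x = G' x"
proof -
  have "AE x in lebesgue_on \<Omega>. G x $ i - G' x $ i = 0" for i
  proof (rule AE_eq_0_if_orthogonal_to_test_functions[OF \<Omega>(1)])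
    show "integrable (lebesgue_on \<Omega>) (\<lambda>x. G x $ i - G' x $ i)"
      by (intro Bochner_Integration.integrable_diff L2_integrable L2_nth G finite_measure_bounded_open \<Omega>)
    fix \<phi> assume \<phi>: "\<phi> \<in> test_functions \<Omega>"
    have "integrable (lebesgue_on \<Omega>) (\<lambda>x. G x $ i * \<phi> x)" "integrable (lebesgue_on \<Omega>) (\<lambda>x. G' x $ i * \<phi> x)"
      using L2_nth[OF G(1)] L2_nth[OF G(2)] test_function_L2(1)[OF \<phi> \<Omega>(1)] by (intro L2_mult_integrable; simp)+
    moreover have "(LINT x|lebesgue_on \<Omega>. G x $ i * \<phi> x) = (LINT x|lebesgue_on \<Omega>. G' x $ i * \<phi> x)"
      using w[unfolded has_weak_gradient_def, rule_format, OF \<phi>, of i] by simp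
    ultimately show "(LINT x|lebesgue_on \<Omega>. (G x $ i - G' x $ i) * \<phi> x) = 0"
      by (simp add: left_diff_distrib)
  qed
  then have "AE x in lebesgue_on \<Omega>. \<forall>i\<in>UNIV. G x $ i - G' x $ i = 0"
    by (subst AE_finite_all) auto
  then show ?thesis by (auto elim!: eventually_mono simp: vec_eq_iff)
qed

lemma weak_grad_works:
  assumes "u \<in> H1 \<Omega>"
  shows "weak_grad \<Omega> u \<in> L2 \<Omega>" "has_weak_gradient \<Omega> u (weak_grad \<Omega> u)"
proof -
  obtain G where "G \<in> L2 \<Omega> \<and> has_weak_gradient \<Omega> u G" using assms unfolding H1_def by blast
  from someI[of "\<lambda>G. G \<in> L2 \<Omega> \<and> has_weak_gradient \<Omega> u G", OF this]
  have "weak_grad \<Omega> u \<in> L2 \<Omega> \<and> has_weak_gradient \<Omega> u (weak_grad \<Omega> u)"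
    unfolding weak_grad_def .
  then show "weak_grad \<Omega> u \<in> L2 \<Omega>" "has_weak_gradient \<Omega> u (weak_grad \<Omega> u)" by blast+
qed

lemma has_weak_gradient_lincomb:
  assumes \<Omega>: "open \<Omega>" and uv: "u \<in> L2 \<Omega>" "v \<in> L2 \<Omega>" and G: "G \<in> L2 \<Omega>" "G' \<in> L2 \<Omega>"
    and w: "has_weak_gradient \<Omega> u G" "has_weak_gradient \<Omega> v G'"
  shows "has_weak_gradient \<Omega> (\<lambda>x. c * u x + d * v x) (\<lambda>x. c *\<^sub>R G x + d *\<^sub>R G' x)"
  unfolding has_weak_gradient_def
proof (intro ballI allI)
  fix \<phi> i assume \<phi>: "\<phi> \<in> test_functions \<Omega>"
  have int: "integrable (lebesgue_on \<Omega>) (\<lambda>x. G x $ i * \<phi> x)" "integrable (lebesgue_on \<Omega>) (\<lambda>x. G' x $ i * \<phi> x)"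
    by (intro L2_mult_integrable L2_nth G test_function_L2(1)[OF \<phi> \<Omega>])+
  have int2: "integrable (lebesgue_on \<Omega>) (\<lambda>x. u x * partial_deriv i \<phi> x)" "integrable (lebesgue_on \<Omega>) (\<lambda>x. v x * partial_deriv i \<phi> x)"
    by (intro L2_mult_integrable uv test_function_L2(2)[OF \<phi> \<Omega>])+
  have "(LINT x|lebesgue_on \<Omega>. (c * u x + d * v x) * partial_deriv i \<phi> x)
      = (LINT x|lebesgue_on \<Omega>. c * (u x * partial_deriv i \<phi> x) + d * (v x * partial_deriv i \<phi> x))"
    by (intro Bochner_Integration.integral_cong refl) (simp add: algebra_simps)
  also have "\<dots> = c * (LINT x|lebesgue_on \<Omega>. u x * partial_deriv i \<phi> x) + d * (LINT x|lebesgue_on \<Omega>. v x * partial_deriv i \<phi> x)"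
    using int2 by simp
  also have "\<dots> = c * - (LINT x|lebesgue_on \<Omega>. G x $ i * \<phi> x) + d * - (LINT x|lebesgue_on \<Omega>. G' x $ i * \<phi> x)"
    using w \<phi> by (simp add: has_weak_gradient_def)
  also have "\<dots> = - (LINT x|lebesgue_on \<Omega>. c * (G x $ i * \<phi> x) + d * (G' x $ i * \<phi> x))"
    using int by simp
  also have "\<dots> = - (LINT x|lebesgue_on \<Omega>. (c *\<^sub>R G x + d *\<^sub>R G' x) $ i * \<phi> x)"
    by (intro arg_cong[where f = uminus] Bochner_Integration.integral_cong refl) (simp add: algebra_simps)
  finally show "(LINT x|lebesgue_on \<Omega>. (c * u x + d * v x) * partial_deriv i \<phi> x)
      = - (LINT x|lebesgue_on \<Omega>. (c *\<^sub>R G x + d *\<^sub>R G' x) $ i * \<phi> x)" .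
qed

lemma H1_lincomb:
  assumes "open \<Omega>" "u \<in> H1 \<Omega>" "v \<in> H1 \<Omega>"
  shows "(\<lambda>x. c * u x + d * v x) \<in> H1 \<Omega>"
proof -
  have uv: "u \<in> L2 \<Omega>" "v \<in> L2 \<Omega>" using assms by (auto simp: H1_def)
  then have "(\<lambda>x. c * u x + d * v x) \<in> L2 \<Omega>" using L2_lincomb[of u \<Omega> v c d] by simp
  then show ?thesis
    using has_weak_gradient_lincomb[OF assms(1) uv weak_grad_works(1)[OF assms(2)] weak_grad_works(1)[OF assms(3)]
        weak_grad_works(2)[OF assms(2)] weak_grad_works(2)[OF assms(3)]]
      L2_lincomb[OF weak_grad_works(1)[OF assms(2)] weak_grad_works(1)[OF assms(3)]]
    unfolding H1_def by blast
qed

lemma weak_grad_lincomb: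
  assumes "open \<Omega>" "bounded \<Omega>" "u \<in> H1 \<Omega>" "v \<in> H1 \<Omega>"
  shows "AE x in lebesgue_on \<Omega>. weak_grad \<Omega> (\<lambda>x. c * u x + d * v x) x = c *\<^sub>R weak_grad \<Omega> u x + d *\<^sub>R weak_grad \<Omega> v x"
proof (rule weak_gradient_unique[OF assms(1,2)])
  note w = weak_grad_works[OF assms(3)] weak_grad_works[OF assms(4)]
  note l = H1_lincomb[OF assms(1,3,4), of c d]
  show "weak_grad \<Omega> (\<lambda>x. c * u x + d * v x) \<in> L2 \<Omega>"
    "has_weak_gradient \<Omega> (\<lambda>x. c * u x + d * v x) (weak_grad \<Omega> (\<lambda>x. c * u x + d * v x))"
    by (rule weak_grad_works[OF l])+
  show "(\<lambda>x. c *\<^sub>R weak_grad \<Omega> u x + d *\<^sub>R weak_grad \<Omega> v x) \<in> L2 \<Omega>"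
    by (rule L2_lincomb[OF w(1,3)])
  show "has_weak_gradient \<Omega> (\<lambda>x. c * u x + d * v x) (\<lambda>x. c *\<^sub>R weak_grad \<Omega> u x + d *\<^sub>R weak_grad \<Omega> v x)"
    using assms by (intro has_weak_gradient_lincomb w) (auto simp: H1_def)
qed

lemma Ck_lincomb: "Ck k f \<Longrightarrow> Ck k g \<Longrightarrow> Ck k (\<lambda>x. c * f x + d * g x)"
proof (induction k arbitrary: f g)
  case 0
  then show ?case by (auto intro!: continuous_intros)
next
  case (Suc k)
  then have diff: "f differentiable_on UNIV" "g differentiable_on UNIV" by auto
  have "(\<lambda>x. c * f x) differentiable_on UNIV" "(\<lambda>x. d * g x) differentiable_on UNIV"
    using diff by (auto intro!: differentiable_on_mult differentiable_on_const)
  then show ?case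
    using Suc diff by (simp add: partial_deriv_add partial_deriv_cmult differentiable_on_add)
qed

lemma test_functions_lincomb:
  assumes "\<phi> \<in> test_functions \<Omega>" "\<psi> \<in> test_functions \<Omega>"
  shows "(\<lambda>x. c * \<phi> x + d * \<psi> x) \<in> test_functions \<Omega>"
proof -
  let ?S = "\<lambda>f. closure {x. f x \<noteq> (0::real)}"
  let ?f = "\<lambda>x. c * \<phi> x + d * \<psi> x"
  have "?S ?f \<subseteq> closure ({x. \<phi> x \<noteq> 0} \<union> {x. \<psi> x \<noteq> 0})"
    by (rule closure_mono) auto
  then have sub: "?S ?f \<subseteq> ?S \<phi> \<union> ?S \<psi>" by simp
  have "compact (?S \<phi> \<union> ?S \<psi>)" using assms by (auto simp: test_functions_def)
  then have "compact (?S ?f)"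
    using sub by (meson closed_closure compact_eq_bounded_closed bounded_subset)
  then show ?thesis
    using assms sub by (auto simp: test_functions_def Ck_lincomb)
qed

text \<open>
  This weak form of the triangle inequality, from \<open>(s + t)\<^sup>2 \<le> 2 s\<^sup>2 + 2 t\<^sup>2\<close>, is enough to see that
  the closure of the test functions is a linear space.
\<close>

lemma H1_norm_lincomb_le:
  assumes "open \<Omega>" "bounded \<Omega>" "u \<in> H1 \<Omega>" "v \<in> H1 \<Omega>"
  shows "(H1_norm \<Omega> (\<lambda>x. c * u x + d * v x))\<^sup>2 \<le> 2 * c\<^sup>2 * (H1_norm \<Omega> u)\<^sup>2 + 2 * d\<^sup>2 * (H1_norm \<Omega> v)\<^sup>2"
proof -
  let ?w = "\<lambda>x. c * u x + d * v x"
  have w: "?w \<in> H1 \<Omega>" by (rule H1_lincomb[OF assms(1,3,4)])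
  have sq: "(H1_norm \<Omega> u)\<^sup>2 = (LINT x|lebesgue_on \<Omega>. (norm (u x))\<^sup>2) + (LINT x|lebesgue_on \<Omega>. (norm (weak_grad \<Omega> u x))\<^sup>2)" for u
    unfolding H1_norm_def by (simp add: integral_nonneg_AE)
  have "(LINT x|lebesgue_on \<Omega>. (norm (?w x))\<^sup>2)
      \<le> 2 * c\<^sup>2 * (LINT x|lebesgue_on \<Omega>. (norm (u x))\<^sup>2) + 2 * d\<^sup>2 * (LINT x|lebesgue_on \<Omega>. (norm (v x))\<^sup>2)"
    using assms w by (intro L2_integral_square_lincomb_le) (auto simp: H1_def)
  moreover have "(LINT x|lebesgue_on \<Omega>. (norm (weak_grad \<Omega> ?w x))\<^sup>2)
      \<le> 2 * c\<^sup>2 * (LINT x|lebesgue_on \<Omega>. (norm (weak_grad \<Omega> u x))\<^sup>2) + 2 * d\<^sup>2 * (LINT x|lebesgue_on \<Omega>. (norm (weak_grad \<Omega> v x))\<^sup>2)"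
    using assms w by (intro L2_integral_square_lincomb_le weak_grad_works weak_grad_lincomb)
  ultimately show ?thesis unfolding sq by (simp add: algebra_simps)
qed

lemma H10_imp_H1: "u \<in> H10 \<Omega> \<Longrightarrow> u \<in> H1 \<Omega>"
  by (simp add: H10_def)

lemma H10_imp_L2: "u \<in> H10 \<Omega> \<Longrightarrow> u \<in> L2 \<Omega>"
  by (simp add: H10_def H1_def)

lemma H10_lincomb:
  assumes \<Omega>: "open \<Omega>" "bounded \<Omega>" and uv: "u \<in> H10 \<Omega>" "v \<in> H10 \<Omega>"
  shows "(\<lambda>x. c * u x + d * v x) \<in> H10 \<Omega>"
proof -
  have "\<exists>\<phi>\<in>test_functions \<Omega>. H1_norm \<Omega> (\<lambda>x. (c * u x + d * v x) - \<phi> x) < e" if "e > 0" for e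
  proof -
    define s where "s = \<bar>c\<bar> + \<bar>d\<bar> + 1"
    \<comment> \<open>Chosen so that \<open>2 c\<^sup>2 \<delta>\<^sup>2 + 2 d\<^sup>2 \<delta>\<^sup>2 \<le> e\<^sup>2 / 2\<close>.\<close>
    define \<delta> where "\<delta> = e / (2 * s)"
    have s: "s \<ge> 1" by (simp add: s_def)
    then have \<delta>: "\<delta> > 0" using that by (simp add: \<delta>_def)
    obtain \<phi> \<psi> where \<phi>: "\<phi> \<in> test_functions \<Omega>" "H1_norm \<Omega> (\<lambda>x. u x - \<phi> x) < \<delta>"
      and \<psi>: "\<psi> \<in> test_functions \<Omega>" "H1_norm \<Omega> (\<lambda>x. v x - \<psi> x) < \<delta>"
      using uv \<delta> unfolding H10_def by blast
    have H1: "(\<lambda>x. u x - \<phi> x) \<in> H1 \<Omega>" "(\<lambda>x. v x - \<psi> x) \<in> H1 \<Omega>"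
      using H1_lincomb[OF \<Omega>(1) H10_imp_H1[OF uv(1)] test_function_H1[OF \<phi>(1) \<Omega>(1)], of 1 "-1"]
        H1_lincomb[OF \<Omega>(1) H10_imp_H1[OF uv(2)] test_function_H1[OF \<psi>(1) \<Omega>(1)], of 1 "-1"] by auto
    have nonneg: "0 \<le> H1_norm \<Omega> w" for w by (simp add: H1_norm_def integral_nonneg_AE)
    have "(H1_norm \<Omega> (\<lambda>x. c * (u x - \<phi> x) + d * (v x - \<psi> x)))\<^sup>2
      \<le> 2 * c\<^sup>2 * (H1_norm \<Omega> (\<lambda>x. u x - \<phi> x))\<^sup>2 + 2 * d\<^sup>2 * (H1_norm \<Omega> (\<lambda>x. v x - \<psi> x))\<^sup>2"
      by (rule H1_norm_lincomb_le[OF \<Omega> H1])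
    also have "\<dots> \<le> 2 * c\<^sup>2 * \<delta>\<^sup>2 + 2 * d\<^sup>2 * \<delta>\<^sup>2"
      using \<phi> \<psi> nonneg by (intro add_mono mult_left_mono power_mono) auto
    also have "\<dots> = 2 * (\<bar>c\<bar>\<^sup>2 + \<bar>d\<bar>\<^sup>2) * \<delta>\<^sup>2" by (simp add: algebra_simps)
    also have "\<dots> \<le> 2 * s\<^sup>2 * \<delta>\<^sup>2"
      unfolding s_def by (intro mult_right_mono mult_left_mono) (auto simp: power2_sum)
    also have "\<dots> = e\<^sup>2 / 2" using s by (simp add: \<delta>_def power_divide power_mult_distrib)
    also have "\<dots> < e\<^sup>2" using that by simp
    finally have "H1_norm \<Omega> (\<lambda>x. c * (u x - \<phi> x) + d * (v x - \<psi> x)) < e"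
      by (rule power_less_imp_less_base) (use that in simp)
    then have "H1_norm \<Omega> (\<lambda>x. (c * u x + d * v x) - (c * \<phi> x + d * \<psi> x)) < e"
      by (simp add: algebra_simps)
    then show ?thesis by (intro bexI[OF _ test_functions_lincomb[OF \<phi>(1) \<psi>(1)]])
  qed
  then show ?thesis
    using H1_lincomb[OF \<Omega>(1) uv[THEN H10_imp_H1]] unfolding H10_def by blast
qed

lemma zero_in_H10:
  assumes \<Omega>: "open \<Omega>" "bounded \<Omega>"
  shows "(\<lambda>x. 0) \<in> H10 \<Omega>"
proof -
  have t: "(\<lambda>x. 0) \<in> test_functions \<Omega>"
    using flat_algebra_Ck[OF flat_algebra.const, of _ "0::real"] by (auto simp: test_functions_def)
  note H = test_function_H1[OF t \<Omega>(1)]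
  have "H1_norm \<Omega> (\<lambda>x. 0 * 0 + 0 * 0) = 0"
    using H1_norm_lincomb_le[OF \<Omega> H H, of 0 0] by simp
  then show ?thesis unfolding H10_def using H t by (auto intro!: bexI[OF _ t])
qed

section \<open>A Hahn--Banach theorem\<close>

text \<open>
  The vector space is a set of functions with pointwise operations, because elements of $L^2$ are
  represented by functions and not by classes modulo null sets.
\<close>

locale function_subspace =
  fixes X :: "('a \<Rightarrow> 'b::real_vector) set"
  assumes zero: "(\<lambda>x. 0) \<in> X"
    and add: "f \<in> X \<Longrightarrow> g \<in> X \<Longrightarrow> (\<lambda>x. f x + g x) \<in> X"
    and scale: "f \<in> X \<Longrightarrow> (\<lambda>x. c *\<^sub>R f x) \<in> X"
begin

definition sublinear :: "(('a \<Rightarrow> 'b) \<Rightarrow> real) \<Rightarrow> bool" where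
  "sublinear q \<longleftrightarrow>
     (\<forall>f\<in>X. \<forall>g\<in>X. q (\<lambda>x. f x + g x) \<le> q f + q g) \<and>
     (\<forall>f\<in>X. \<forall>c\<ge>0. q (\<lambda>x. c *\<^sub>R f x) = c * q f)"

text \<open>
  A pair \<open>(f, b)\<close> is read as the demand that a functional be at least \<open>b\<close> at \<open>f\<close>. Such demands can
  be added and scaled.
\<close>

definition convex_cone :: "(('a \<Rightarrow> 'b) \<times> real) set \<Rightarrow> bool" where
  "convex_cone C \<longleftrightarrow> C \<subseteq> X \<times> UNIV \<and> ((\<lambda>x. 0), 0) \<in> C \<and>
     (\<forall>f b g c. (f, b) \<in> C \<longrightarrow> (g, c) \<in> C \<longrightarrow> ((\<lambda>x. f x + g x), b + c) \<in> C) \<and>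
     (\<forall>f b t. (f, b) \<in> C \<longrightarrow> t > 0 \<longrightarrow> ((\<lambda>x. t *\<^sub>R f x), t * b) \<in> C)"

lemma sublinear_add: "sublinear q \<Longrightarrow> f \<in> X \<Longrightarrow> g \<in> X \<Longrightarrow> q (\<lambda>x. f x + g x) \<le> q f + q g"
  by (simp add: sublinear_def)

lemma sublinear_scale: "sublinear q \<Longrightarrow> f \<in> X \<Longrightarrow> 0 \<le> c \<Longrightarrow> q (\<lambda>x. c *\<^sub>R f x) = c * q f"
  by (simp add: sublinear_def)

lemma sublinear_zero: "sublinear q \<Longrightarrow> q (\<lambda>x. 0) = 0"
  using sublinear_scale[of q "\<lambda>x. 0" 0] zero by simp

lemma uminus: "f \<in> X \<Longrightarrow> (\<lambda>x. - f x) \<in> X"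
  using scale[of f "-1"] by simp

lemma sublinear_lower: "sublinear q \<Longrightarrow> f \<in> X \<Longrightarrow> - q (\<lambda>x. - f x) \<le> q f"
  using sublinear_add[of q f "\<lambda>x. - f x"] sublinear_zero[of q] uminus[of f] by simp

text \<open>
  If \<open>q\<close> satisfies all demands in \<open>C\<close>, the infimum of \<open>q (f + g) - b\<close> over \<open>(g, b) \<in> C\<close> is the largest
  sublinear functional below \<open>q\<close> whose values at \<open>- g\<close> are at most \<open>- b\<close>. Every linear functional
  below it then meets the demands. The construction serves twice: for the given cone, and for the
  ray through a single element in order to show that minimal functionals are linear. The value zero
  outside \<open>X\<close> makes functionals that agree on \<open>X\<close> equal, as Zorn's lemma needs antisymmetry.
\<close>

lemma sublinear_reduce:
  assumes q: "sublinear q" and C: "convex_cone C" and le: "\<And>f b. (f, b) \<in> C \<Longrightarrow> b \<le> q f"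
  obtains r where "sublinear r" "\<And>f. f \<in> X \<Longrightarrow> r f \<le> q f" "\<And>f b. (f, b) \<in> C \<Longrightarrow> r (\<lambda>x. - f x) \<le> - b"
    "\<And>f. f \<notin> X \<Longrightarrow> r f = 0"
proof -
  define S where "S f = {q (\<lambda>x. f x + g x) - b | g b. (g, b) \<in> C}" for f
  define r where "r f = (if f \<in> X then Inf (S f) else 0)" for f
  have C0: "((\<lambda>x. 0), 0) \<in> C" and CX: "\<And>f b. (f, b) \<in> C \<Longrightarrow> f \<in> X"
    and Cadd: "\<And>f b g c. (f, b) \<in> C \<Longrightarrow> (g, c) \<in> C \<Longrightarrow> ((\<lambda>x. f x + g x), b + c) \<in> C"
    and Cscale: "\<And>f b t. (f, b) \<in> C \<Longrightarrow> t > 0 \<Longrightarrow> ((\<lambda>x. t *\<^sub>R f x), t * b) \<in> C"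
    using C unfolding convex_cone_def by blast+
  have ne: "S f \<noteq> {}" for f using C0 by (auto simp: S_def)
  \<comment> \<open>Subadditivity bounds the set below, so that its infimum is a genuine one.\<close>
  have lower: "- q (\<lambda>x. - f x) \<le> s" if fX: "f \<in> X" and sS: "s \<in> S f" for f s
  proof -
    obtain g b where g: "(g, b) \<in> C" "s = q (\<lambda>x. f x + g x) - b" using sS by (auto simp: S_def)
    have "b \<le> q g" by (rule le[OF g(1)])
    also have "q g = q (\<lambda>x. (f x + g x) + - f x)" by simp
    also have "\<dots> \<le> q (\<lambda>x. f x + g x) + q (\<lambda>x. - f x)"
      using CX[OF g(1)] fX by (intro sublinear_add[OF q]) (auto intro: add uminus)
    finally show ?thesis using g by simp
  qed
  then have bdd: "bdd_below (S f)" if "f \<in> X" for f using that by (auto simp: bdd_below_def)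
  have rle: "r f \<le> q (\<lambda>x. f x + g x) - b" if "f \<in> X" "(g, b) \<in> C" for f g b
    unfolding r_def using that bdd by (auto simp: S_def intro!: cInf_lower)
  have rge: "m \<le> r f" if "f \<in> X" "\<And>g b. (g, b) \<in> C \<Longrightarrow> m \<le> q (\<lambda>x. f x + g x) - b" for f m
  proof -
    have "m \<le> Inf (S f)" using that(2) by (intro cInf_greatest[OF ne]) (auto simp: S_def)
    then show ?thesis using that(1) by (simp add: r_def)
  qed
  have radd: "r (\<lambda>x. f x + g x) \<le> r f + r g" if X: "f \<in> X" "g \<in> X" for f g
  proof -
    have *: "r (\<lambda>x. f x + g x) \<le> (q (\<lambda>x. f x + h x) - b) + (q (\<lambda>x. g x + k x) - c)"
      if C: "(h, b) \<in> C" "(k, c) \<in> C" for h b k c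
    proof -
      have "r (\<lambda>x. f x + g x) \<le> q (\<lambda>x. (f x + g x) + (h x + k x)) - (b + c)"
        by (rule rle) (auto intro: add X Cadd C)
      also have "(\<lambda>x. (f x + g x) + (h x + k x)) = (\<lambda>x. (f x + h x) + (g x + k x))"
        by (simp add: algebra_simps)
      also have "q \<dots> \<le> q (\<lambda>x. f x + h x) + q (\<lambda>x. g x + k x)"
        by (intro sublinear_add[OF q] add X CX[OF C(1)] CX[OF C(2)])
      finally show ?thesis by simp
    qed
    have "r (\<lambda>x. f x + g x) - (q (\<lambda>x. g x + k x) - c) \<le> r f" if "(k, c) \<in> C" for k c
      using *[OF _ that] by (intro rge X) (simp add: algebra_simps)
    then have "r (\<lambda>x. f x + g x) - r f \<le> r g"
      by (intro rge X) (simp add: algebra_simps)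
    then show ?thesis by simp
  qed
  have rscale: "r (\<lambda>x. t *\<^sub>R f x) = t * r f" if X: "f \<in> X" and t: "t \<ge> 0" for f t
  proof (cases "t = 0")
    case True
    have "r (\<lambda>x. 0) = 0"
    proof (rule antisym)
      show "r (\<lambda>x. 0) \<le> 0" using rle[OF zero C0] sublinear_zero[OF q] by simp
      show "0 \<le> r (\<lambda>x. 0)" using le by (intro rge zero) simp
    qed
    then show ?thesis using True by simp
  next
    case False
    have ineq: "t * r f \<le> r (\<lambda>x. t *\<^sub>R f x)" if X: "f \<in> X" and t: "t > 0" for f t
    proof (rule rge)
      fix g b assume g: "(g, b) \<in> C"
      have "r f \<le> q (\<lambda>x. f x + inverse t *\<^sub>R g x) - inverse t * b"
        by (intro rle X Cscale g) (use t in simp)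
      then have "t * r f \<le> t * q (\<lambda>x. f x + inverse t *\<^sub>R g x) - b"
        using t by (simp add: field_simps)
      also have "t * q (\<lambda>x. f x + inverse t *\<^sub>R g x) = q (\<lambda>x. t *\<^sub>R (f x + inverse t *\<^sub>R g x))"
        using t by (intro sublinear_scale[OF q, symmetric] add X scale CX[OF g]) auto
      also have "(\<lambda>x. t *\<^sub>R (f x + inverse t *\<^sub>R g x)) = (\<lambda>x. t *\<^sub>R f x + g x)"
        using t by (simp add: scaleR_add_right)
      finally show "t * r f \<le> q (\<lambda>x. t *\<^sub>R f x + g x) - b" .
    qed (rule scale[OF X])
    have t: "t > 0" using t False by simp
    have "inverse t * r (\<lambda>x. t *\<^sub>R f x) \<le> r (\<lambda>x. inverse t *\<^sub>R (t *\<^sub>R f x))"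
      by (intro ineq scale X) (use t in simp)
    then have "r (\<lambda>x. t *\<^sub>R f x) \<le> t * r f" using t by (simp add: field_simps)
    then show ?thesis using ineq[OF X t] by simp
  qed
  show thesis
  proof
    show "sublinear r" unfolding sublinear_def using radd rscale by blast
    show "r f \<le> q f" if "f \<in> X" for f using rle[OF that C0] by simp
    show "r (\<lambda>x. - f x) \<le> - b" if "(f, b) \<in> C" for f b
      using rle[OF uminus[OF CX[OF that]] that] sublinear_zero[OF q] by simp
    show "r f = 0" if "f \<notin> X" for f using that by (simp add: r_def)
  qed
qed

text \<open>
  Zorn's lemma: the pointwise infimum of a chain of sublinear functionals below \<open>p\<close> is finite, since
  all of them are at least \<open>- p (- f)\<close>, and it is again sublinear because of any two members of the
  chain one lies below the other.
\<close>

lemma minimal_sublinear_exists: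
  assumes p: "sublinear p"
  obtains q where "sublinear q" "\<And>f. f \<in> X \<Longrightarrow> q f \<le> p f"
    "\<And>r. sublinear r \<Longrightarrow> (\<And>f. f \<in> X \<Longrightarrow> r f \<le> q f) \<Longrightarrow> (\<And>f. f \<in> X \<Longrightarrow> r f = q f)"
proof -
  define A where "A = {q. sublinear q \<and> (\<forall>f\<in>X. q f \<le> p f) \<and> (\<forall>f. f \<notin> X \<longrightarrow> q f = 0)}"
  define P :: "(('a \<Rightarrow> 'b) \<Rightarrow> real) \<Rightarrow> (('a \<Rightarrow> 'b) \<Rightarrow> real) \<Rightarrow> bool" where "P q r \<longleftrightarrow> r \<le> q" for q r
  have "partial_order_on A (relation_of P A)"
    by (rule partial_order_on_relation_ofI) (auto simp: P_def)
  moreover have "\<exists>u\<in>A. \<forall>q\<in>K. P q u" if K: "K \<in> Chains (relation_of P A)" for K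
  proof (cases "K = {}")
    case True
    \<comment> \<open>The trivial cone serves to replace \<open>p\<close> by a functional that vanishes outside \<open>X\<close>.\<close>
    have "convex_cone {((\<lambda>x. 0), 0)}" unfolding convex_cone_def using zero by auto
    moreover have "b \<le> p f" if "(f, b) \<in> {((\<lambda>x. 0), 0)}" for f b
      using that sublinear_zero[OF p] by simp
    ultimately obtain r where "sublinear r" "\<And>f. f \<in> X \<Longrightarrow> r f \<le> p f" "\<And>f. f \<notin> X \<Longrightarrow> r f = 0"
      by (rule sublinear_reduce[OF p]) blast+
    then show ?thesis using True by (auto simp: A_def)
  next
    case False
    have KA: "K \<subseteq> A" using K by (auto simp: Chains_def relation_of_def)
    then have sub: "sublinear q" if "q \<in> K" for q using that by (auto simp: A_def)
    have chain: "q \<le> r \<or> r \<le> q" if "q \<in> K" "r \<in> K" for q r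
      using K that by (auto simp: Chains_def relation_of_def P_def)
    define u where "u f = (INF q\<in>K. q f)" for f
    have lower: "- p (\<lambda>x. - f x) \<le> q f" if "q \<in> K" "f \<in> X" for q f
      using sublinear_lower[OF sub that(2)] KA uminus[OF that(2)] that(1) by (fastforce simp: A_def)
    have bdd: "bdd_below ((\<lambda>q. q f) ` K)" if "f \<in> X" for f
      using lower[OF _ that] by (auto simp: bdd_below_def)
    have ule: "u f \<le> q f" if "q \<in> K" "f \<in> X" for q f
      unfolding u_def using that bdd by (intro cINF_lower) auto
    have uge: "m \<le> u f" if "\<And>q. q \<in> K \<Longrightarrow> m \<le> q f" for m f
      unfolding u_def using that False by (intro cINF_greatest) auto
    have "u \<in> A"
      unfolding A_def sublinear_def
    proof (intro CollectI conjI ballI allI impI)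
      fix f g assume X: "f \<in> X" "g \<in> X"
      have *: "u (\<lambda>x. f x + g x) \<le> q f + r g" if qr: "q \<in> K" "r \<in> K" for q r
      proof -
        obtain s where s: "s \<in> K" "s \<le> q" "s \<le> r" using chain[OF qr] qr by auto
        have "u (\<lambda>x. f x + g x) \<le> s (\<lambda>x. f x + g x)" by (intro ule s add X)
        also have "\<dots> \<le> s f + s g" by (intro sublinear_add sub s X)
        also have "\<dots> \<le> q f + r g" using s by (intro add_mono) (auto simp: le_fun_def)
        finally show ?thesis .
      qed
      have "u (\<lambda>x. f x + g x) - r g \<le> u f" if "r \<in> K" for r
        using *[OF _ that] by (intro uge) (simp add: algebra_simps)
      then have "u (\<lambda>x. f x + g x) - u f \<le> u g"
        by (intro uge) (simp add: algebra_simps)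
      then show "u (\<lambda>x. f x + g x) \<le> u f + u g" by simp
    next
      fix f c assume X: "f \<in> X" and c: "(0::real) \<le> c"
      have "u (\<lambda>x. c *\<^sub>R f x) = (INF q\<in>K. c * q f)"
        unfolding u_def using sublinear_scale[OF sub X c] by (intro INF_cong) auto
      also have "\<dots> = c * u f"
      proof (rule antisym)
        show "c * u f \<le> (INF q\<in>K. c * q f)"
          using ule[OF _ X] c False by (intro cINF_greatest) (auto intro: mult_left_mono)
        have bdd': "bdd_below ((\<lambda>q. c * q f) ` K)"
          using mult_left_mono[OF lower[OF _ X] c] by (auto simp: bdd_below_def)
        have le: "(INF q\<in>K. c * q f) \<le> c * q f" if "q \<in> K" for q
          by (rule cINF_lower[OF bdd' that])
        show "(INF q\<in>K. c * q f) \<le> c * u f"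
        proof (cases "c = 0")
          case True
          then show ?thesis using False by simp
        next
          case False
          then have "c > 0" using c by simp
          then have "(INF q\<in>K. c * q f) / c \<le> u f"
            using le by (intro uge) (simp add: field_simps)
          then show ?thesis using \<open>c > 0\<close> by (simp add: field_simps)
        qed
      qed
      finally show "u (\<lambda>x. c *\<^sub>R f x) = c * u f" .
    next
      fix f assume X: "f \<in> X"
      obtain q where "q \<in> K" using False by auto
      then show "u f \<le> p f" using ule[OF _ X] KA X by (fastforce simp: A_def)
    next
      fix f assume "f \<notin> X"
      then have "q f = 0" if "q \<in> K" for q using KA that by (auto simp: A_def)
      then have "(\<lambda>q. q f) ` K = {0}" using False by (auto simp: image_iff)
      then show "u f = 0" by (simp add: u_def)
    qed
    moreover have "P q u" if "q \<in> K" for q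
      unfolding P_def le_fun_def
    proof
      fix f show "u f \<le> q f"
      proof (cases "f \<in> X")
        case True then show ?thesis by (rule ule[OF that])
      next
        case False
        then show ?thesis using \<open>u \<in> A\<close> KA that by (auto simp: A_def)
      qed
    qed
    ultimately show ?thesis by blast
  qed
  ultimately obtain q where q: "q \<in> A" and min: "\<forall>r\<in>A. P q r \<longrightarrow> r = q"
    using predicate_Zorn[of A P] by blast
  show thesis
  proof
    show "sublinear q" "\<And>f. f \<in> X \<Longrightarrow> q f \<le> p f" using q by (auto simp: A_def)
    fix r f assume r: "sublinear r" "\<And>f. f \<in> X \<Longrightarrow> r f \<le> q f" and f: "f \<in> X"
    define r' where "r' f = (if f \<in> X then r f else 0)" for f
    have "sublinear r'" using r(1) add scale by (auto simp: sublinear_def r'_def)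
    moreover have "r' f \<le> p f" if "f \<in> X" for f
      using r(2)[OF that] q that by (force simp: A_def r'_def)
    ultimately have "r' \<in> A" by (simp add: A_def r'_def)
    moreover have "r' \<le> q" using r(2) q by (auto simp: le_fun_def r'_def A_def)
    ultimately have "r' = q" using min unfolding P_def by blast
    then have "r' f = q f" by (rule fun_cong)
    then show "r f = q f" using f by (simp add: r'_def)
  qed
qed

definition linear_functional :: "(('a \<Rightarrow> 'b) \<Rightarrow> real) \<Rightarrow> bool" where
  "linear_functional l \<longleftrightarrow>
     (\<forall>f\<in>X. \<forall>g\<in>X. l (\<lambda>x. f x + g x) = l f + l g) \<and> (\<forall>f\<in>X. \<forall>c. l (\<lambda>x. c *\<^sub>R f x) = c * l f)"

text \<open>
  The Hahn--Banach theorem in the form of Mazur and Orlicz. The demands are built into a smaller sublinear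
  functional, below which a minimal one is chosen. A minimal functional \<open>q\<close> is linear: reducing it
  along the ray through \<open>f\<close> cannot change it, hence \<open>q (- f) \<le> - q f\<close>.
\<close>

lemma Hahn_Banach_cone:
  assumes p: "sublinear p" and C: "convex_cone C" and le: "\<And>f b. (f, b) \<in> C \<Longrightarrow> b \<le> p f"
  obtains l where "linear_functional l" "\<And>f. f \<in> X \<Longrightarrow> l f \<le> p f" "\<And>f b. (f, b) \<in> C \<Longrightarrow> b \<le> l f"
proof -
  obtain p' where p': "sublinear p'" "\<And>f. f \<in> X \<Longrightarrow> p' f \<le> p f" "\<And>f b. (f, b) \<in> C \<Longrightarrow> p' (\<lambda>x. - f x) \<le> - b"
    by (rule sublinear_reduce[OF p C le]) blast+
  obtain q where q: "sublinear q" "\<And>f. f \<in> X \<Longrightarrow> q f \<le> p' f"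
    and min: "\<And>r f. sublinear r \<Longrightarrow> (\<And>f. f \<in> X \<Longrightarrow> r f \<le> q f) \<Longrightarrow> f \<in> X \<Longrightarrow> r f = q f"
    by (rule minimal_sublinear_exists[OF p'(1)]) blast
  have neg: "q (\<lambda>x. - f x) = - q f" if f: "f \<in> X" for f
  proof (rule antisym)
    let ?C = "{((\<lambda>x. t *\<^sub>R f x), t * q f) | t. t \<ge> 0}"
    have "convex_cone ?C"
      unfolding convex_cone_def
    proof (intro conjI ballI allI impI; clarify)
      fix t assume "t \<ge> (0::real)"
      show "(\<lambda>x. t *\<^sub>R f x) \<in> X \<and> t * q f \<in> UNIV" using scale[OF f] by simp
    next
      show "\<exists>t. ((\<lambda>x. 0), 0) = ((\<lambda>x. t *\<^sub>R f x), t * q f) \<and> t \<ge> 0" by (intro exI[of _ 0]) simp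
    next
      fix t s assume "t \<ge> (0::real)" "s \<ge> (0::real)"
      then show "\<exists>ta. ((\<lambda>x. t *\<^sub>R f x + s *\<^sub>R f x), t * q f + s * q f) = ((\<lambda>x. ta *\<^sub>R f x), ta * q f) \<and> 0 \<le> ta"
        by (intro exI[of _ "t + s"]) (simp add: algebra_simps)
    next
      fix t s assume "t \<ge> (0::real)" "s > (0::real)"
      then show "\<exists>ta. ((\<lambda>x. s *\<^sub>R t *\<^sub>R f x), s * (t * q f)) = ((\<lambda>x. ta *\<^sub>R f x), ta * q f) \<and> 0 \<le> ta"
        by (intro exI[of _ "s * t"]) (simp add: algebra_simps)
    qed
    moreover have "b \<le> q g" if "(g, b) \<in> ?C" for g b
      using that sublinear_scale[OF q(1) f] by auto
    ultimately obtain r where r: "sublinear r" "\<And>f. f \<in> X \<Longrightarrow> r f \<le> q f"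
        "\<And>g b. (g, b) \<in> ?C \<Longrightarrow> r (\<lambda>x. - g x) \<le> - b"
      by (rule sublinear_reduce[OF q(1)]) blast+
    have "(f, q f) \<in> ?C" by (auto intro!: exI[of _ 1])
    from r(3)[OF this] show "q (\<lambda>x. - f x) \<le> - q f"
      using min[OF r(1,2) uminus[OF f]] by simp
    show "- q f \<le> q (\<lambda>x. - f x)" using sublinear_lower[OF q(1) uminus[OF f]] by simp
  qed
  have "linear_functional q"
    unfolding linear_functional_def
  proof (intro conjI ballI allI)
    fix f g assume X: "f \<in> X" "g \<in> X"
    have "q f = q (\<lambda>x. (f x + g x) + - g x)" by simp
    also have "\<dots> \<le> q (\<lambda>x. f x + g x) + q (\<lambda>x. - g x)"
      by (intro sublinear_add[OF q(1)] add uminus X)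
    finally show "q (\<lambda>x. f x + g x) = q f + q g"
      using neg[OF X(2)] sublinear_add[OF q(1) X] by simp
  next
    fix f and c :: real assume X: "f \<in> X"
    show "q (\<lambda>x. c *\<^sub>R f x) = c * q f"
    proof (cases "c \<ge> 0")
      case True then show ?thesis by (rule sublinear_scale[OF q(1) X])
    next
      case False
      then have "q (\<lambda>x. (- c) *\<^sub>R f x) = (- c) * q f" by (intro sublinear_scale[OF q(1) X]) simp
      then show ?thesis using neg[OF scale[OF X, of c]] by simp
    qed
  qed
  moreover have "q f \<le> p f" if "f \<in> X" for f
    using q(2)[OF that] p'(2)[OF that] by simp
  moreover have "b \<le> q f" if "(f, b) \<in> C" for f b
  proof -
    have X: "f \<in> X" using C that by (auto simp: convex_cone_def)
    show ?thesis using p'(3)[OF that] q(2)[OF uminus[OF X]] neg[OF X] by simp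
  qed
  ultimately show thesis using that by blast
qed

end

section \<open>Representation of dominated functionals on $L^2$\<close>

lemma L2_const:
  assumes "finite_measure (lebesgue_on \<Omega>)"
  shows "(\<lambda>x. c) \<in> L2 \<Omega>"
proof -
  interpret finite_measure "lebesgue_on \<Omega>" by fact
  show ?thesis by (simp add: L2_def)
qed

lemma function_subspace_L2: 
  assumes "finite_measure (lebesgue_on \<Omega>)"
  shows "function_subspace (L2 \<Omega>)"
  by unfold_locales (auto intro: L2_const assms L2_add L2_scaleR)

text \<open>
  Otherwise integrating over the set where \<open>g < f\<close> gives a strict inequality in the wrong direction.
\<close>

lemma nonneg_le_AE_if_nn_integral_le:
  fixes f g :: "'a \<Rightarrow> ennreal"
  assumes f: "f \<in> borel_measurable M" and g: "g \<in> borel_measurable M" and fin: "(\<integral>\<^sup>+x. g x \<partial>M) < \<infinity>"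
    and le: "\<And>A. A \<in> sets M \<Longrightarrow> (\<integral>\<^sup>+x. f x * indicator A x \<partial>M) \<le> (\<integral>\<^sup>+x. g x * indicator A x \<partial>M)"
  shows "AE x in M. f x \<le> g x"
proof -
  define E where "E = {x \<in> space M. g x < f x}"
  have E: "E \<in> sets M" unfolding E_def using f g by measurable
  have "AE x in M. f x * indicator E x \<le> g x * indicator E x"
  proof (rule ccontr)
    assume "\<not> (AE x in M. f x * indicator E x \<le> g x * indicator E x)"
    moreover have "(\<integral>\<^sup>+x. g x * indicator E x \<partial>M) \<le> (\<integral>\<^sup>+x. g x \<partial>M)"
      by (intro nn_integral_mono) (auto simp: indicator_def)
    then have "(\<integral>\<^sup>+x. g x * indicator E x \<partial>M) \<noteq> \<infinity>" using fin by auto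
    moreover have "AE x in M. g x * indicator E x \<le> f x * indicator E x"
      by (intro AE_I2) (auto simp: E_def indicator_def)
    ultimately have "(\<integral>\<^sup>+x. g x * indicator E x \<partial>M) < (\<integral>\<^sup>+x. f x * indicator E x \<partial>M)"
      using f g E by (intro nn_integral_less) auto
    then show False using le[OF E] by simp
  qed
  moreover have "AE x in M. x \<in> space M" by simp
  ultimately show ?thesis
  proof eventually_elim
    case (elim x)
    then show ?case by (cases "g x < f x") (auto simp: E_def)
  qed
qed

lemma scaleR_indicator_L2:
  fixes b :: "'b::euclidean_space"
  assumes "finite_measure (lebesgue_on \<Omega>)" "A \<in> sets (lebesgue_on \<Omega>)"
  shows "(\<lambda>x. indicator A x *\<^sub>R b) \<in> L2 \<Omega>"
  by (rule L2_bound[OF L2_const[OF assms(1), of b]])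
    (use assms in \<open>auto simp: indicator_def intro!: borel_measurable_scaleR borel_measurable_indicator\<close>)

locale dominated_L2_functional =
  fixes \<Omega> :: "'a::euclidean_space set" and a :: "'a \<Rightarrow> real"
    and l :: "('a \<Rightarrow> 'b::euclidean_space) \<Rightarrow> real"
  assumes fin: "finite_measure (lebesgue_on \<Omega>)"
    and a: "a \<in> L2 \<Omega>" "AE x in lebesgue_on \<Omega>. 0 \<le> a x"
    and l_add: "f \<in> L2 \<Omega> \<Longrightarrow> g \<in> L2 \<Omega> \<Longrightarrow> l (\<lambda>x. f x + g x) = l f + l g"
    and l_scale: "f \<in> L2 \<Omega> \<Longrightarrow> l (\<lambda>x. c *\<^sub>R f x) = c * l f"
    and l_le: "f \<in> L2 \<Omega> \<Longrightarrow> l f \<le> (LINT x|lebesgue_on \<Omega>. a x * norm (f x))"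
begin

abbreviation "M \<equiv> lebesgue_on \<Omega>"

sublocale finite_measure M by (rule fin)

lemma l_abs_le: "f \<in> L2 \<Omega> \<Longrightarrow> \<bar>l f\<bar> \<le> (LINT x|M. a x * norm (f x))"
  using l_le[of f] l_le[of "\<lambda>x. (-1) *\<^sub>R f x"] l_scale[of f "-1"] L2_scaleR[of f \<Omega> "-1"] by (simp add: abs_le_iff)

lemma l_diff: "f \<in> L2 \<Omega> \<Longrightarrow> g \<in> L2 \<Omega> \<Longrightarrow> l (\<lambda>x. f x - g x) = l f - l g"
  using l_add[of f "\<lambda>x. (-1) *\<^sub>R g x"] l_scale[of g "-1"] L2_scaleR[of g \<Omega> "-1"] by simp

lemma a_integrable: "integrable M a"
  by (rule L2_integrable[OF a(1) fin])

lemma a_mult_integrable: "f \<in> L2 \<Omega> \<Longrightarrow> integrable M (\<lambda>x. a x * norm (f x))"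
  by (rule L2_mult_integrable[OF a(1) L2_norm])

text \<open>
  The set function \<open>\<nu> A = l (1\<^sub>A b)\<close> satisfies \<open>|\<nu> A| \<le> \<integral>\<^sub>A a\<close>. Adding \<open>\<alpha> A = \<integral>\<^sub>A a\<close> makes it
  nonnegative; it is then a measure between \<open>0\<close> and \<open>2 \<alpha>\<close>, absolutely continuous, and its density
  lies between \<open>0\<close> and \<open>2 a\<close>. Countable additivity follows from additivity since \<open>\<alpha>\<close> tends to zero
  along decreasing sequences of sets with empty intersection.
\<close>

lemma density_along_direction:
  assumes b: "norm b = 1"
  obtains g where "g \<in> borel_measurable M" "AE x in M. \<bar>g x\<bar> \<le> a x"
    "\<And>A. A \<in> sets M \<Longrightarrow> l (\<lambda>x. indicator A x *\<^sub>R b) = (LINT x|M. g x * indicator A x)"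
proof -
  define \<nu> where "\<nu> A = l (\<lambda>x. indicator A x *\<^sub>R b)" for A
  define \<alpha> where "\<alpha> A = (LINT x|M. a x * indicator A x)" for A
  define \<mu> where "\<mu> A = ennreal (\<nu> A + \<alpha> A)" for A
  note ind = scaleR_indicator_L2[OF fin, of _ b]
  have aint: "integrable M (\<lambda>x. a x * indicator A x)" if "A \<in> sets M" for A
    using integrable_mult_indicator[OF that a_integrable] by (simp add: mult.commute)
  have \<nu>_le: "\<bar>\<nu> A\<bar> \<le> \<alpha> A" if "A \<in> sets M" for A
    using l_abs_le[OF ind[OF that]] b by (simp add: \<nu>_def \<alpha>_def)
  have \<nu>_add: "\<nu> (A \<union> B) = \<nu> A + \<nu> B" if "A \<in> sets M" "B \<in> sets M" "A \<inter> B = {}" for A B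
  proof -
    have "(\<lambda>x. indicator (A \<union> B) x *\<^sub>R b) = (\<lambda>x. indicator A x *\<^sub>R b + indicator B x *\<^sub>R b)"
      using that(3) by (auto simp: indicator_def fun_eq_iff)
    then show ?thesis using l_add[OF ind[OF that(1)] ind[OF that(2)]] by (simp add: \<nu>_def)
  qed
  have \<alpha>_add: "\<alpha> (A \<union> B) = \<alpha> A + \<alpha> B" if "A \<in> sets M" "B \<in> sets M" "A \<inter> B = {}" for A B
  proof -
    have "(\<lambda>x. a x * indicator (A \<union> B) x) = (\<lambda>x. a x * indicator A x + a x * indicator B x)"
      using that(3) by (auto simp: indicator_def fun_eq_iff)
    then show ?thesis using aint[OF that(1)] aint[OF that(2)] by (simp add: \<alpha>_def)
  qed
  have pos: "positive (sets M) \<mu>"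
    using l_scale[OF L2_const[OF fin, of 0], of 0] by (simp add: positive_def \<mu>_def \<nu>_def \<alpha>_def)
  have add: "additive (sets M) \<mu>"
    unfolding additive_def \<mu>_def
  proof (intro ballI impI)
    fix A B assume "A \<in> sets M" "B \<in> sets M" "A \<inter> B = {}"
    then show "ennreal (\<nu> (A \<union> B) + \<alpha> (A \<union> B)) = ennreal (\<nu> A + \<alpha> A) + ennreal (\<nu> B + \<alpha> B)"
      using \<nu>_le[of A] \<nu>_le[of B] by (simp add: \<nu>_add \<alpha>_add ennreal_plus[symmetric] del: ennreal_plus)
  qed
  have ca: "countably_additive (sets M) \<mu>"
  proof (rule sets.empty_continuous_imp_countably_additive[OF pos add])
    show "\<forall>A\<in>sets M. \<mu> A \<noteq> \<infinity>" by (simp add: \<mu>_def)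
    fix A :: "nat \<Rightarrow> 'a set" assume A: "range A \<subseteq> sets M" "decseq A" "(\<Inter>i. A i) = {}"
    then have As: "A i \<in> sets M" for i by auto
    have "(\<lambda>i. \<alpha> (A i)) \<longlonglongrightarrow> (LINT x|M. 0)"
      unfolding \<alpha>_def
    proof (rule integral_dominated_convergence[where w = "\<lambda>x. \<bar>a x\<bar>"])
      show "AE x in M. (\<lambda>i. a x * indicator (A i) x) \<longlonglongrightarrow> 0"
      proof (intro AE_I2)
        fix x
        obtain i where i: "x \<notin> A i" using A(3) by auto
        have "a x * indicator (A j) x = 0" if "j \<ge> i" for j
          using i decseqD[OF A(2) that] by (auto simp: indicator_def)
        then show "(\<lambda>i. a x * indicator (A i) x) \<longlonglongrightarrow> 0"
          by (intro tendsto_eventually) (auto simp: eventually_sequentially)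
      qed
      show "(\<lambda>x. a x * indicator (A i) x) \<in> borel_measurable M" for i
        using aint[OF As] by auto
    qed (use a_integrable in \<open>auto simp: indicator_def\<close>)
    then have "(\<lambda>i. 2 * \<alpha> (A i)) \<longlonglongrightarrow> 0" by (auto intro: tendsto_eq_intros)
    then have "(\<lambda>i. \<nu> (A i) + \<alpha> (A i)) \<longlonglongrightarrow> 0"
    proof (rule tendsto_sandwich[OF _ _ tendsto_const, rotated 2])
      show "\<forall>\<^sub>F i in sequentially. 0 \<le> \<nu> (A i) + \<alpha> (A i)"
        using \<nu>_le[OF As] by (intro always_eventually allI) (simp add: abs_le_iff, smt (verit))
      show "\<forall>\<^sub>F i in sequentially. \<nu> (A i) + \<alpha> (A i) \<le> 2 * \<alpha> (A i)"
        using \<nu>_le[OF As] by (intro always_eventually allI) (simp add: abs_le_iff)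
    qed
    from tendsto_ennrealI[OF this] show "(\<lambda>i. \<mu> (A i)) \<longlonglongrightarrow> 0" by (simp add: \<mu>_def)
  qed
  define M' where "M' = measure_of (space M) (sets M) \<mu>"
  have sets_M': "sets M' = sets M" unfolding M'_def by (rule sets.sets_measure_of_eq)
  have em: "emeasure M' A = \<mu> A" if "A \<in> sets M" for A
    unfolding M'_def by (rule emeasure_measure_of_sigma[OF sets.sigma_algebra_axioms pos ca that])
  have "absolutely_continuous M M'"
    unfolding absolutely_continuous_def
  proof
    fix A assume A: "A \<in> null_sets M"
    then have s: "A \<in> sets M" by auto
    have "AE x in M. x \<notin> A" by (rule AE_not_in[OF A])
    then have "AE x in M. a x * indicator A x = 0" by eventually_elim simp
    then have "\<alpha> A = (LINT x|M. 0)" unfolding \<alpha>_def using aint[OF s] by (intro integral_cong_AE) auto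
    then have "\<mu> A = 0" using \<nu>_le[OF s] by (simp add: \<mu>_def)
    then show "A \<in> null_sets M'" using s em[OF s] sets_M' by (auto simp: null_sets_def)
  qed
  from Radon_Nikodym[OF this sets_M'] obtain f where f: "f \<in> borel_measurable M" "density M f = M'" by blast
  have nn: "(\<integral>\<^sup>+x. f x * indicator A x \<partial>M) = ennreal (\<nu> A + \<alpha> A)" if "A \<in> sets M" for A
    using emeasure_density[OF f(1) that] em[OF that] f(2) by (simp add: \<mu>_def)
  have nna: "(\<integral>\<^sup>+x. ennreal (2 * a x) * indicator A x \<partial>M) = ennreal (2 * \<alpha> A)" if "A \<in> sets M" for A
  proof -
    have "(\<integral>\<^sup>+x. ennreal (2 * a x) * indicator A x \<partial>M) = (\<integral>\<^sup>+x. ennreal (2 * (a x * indicator A x)) \<partial>M)"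
      by (intro nn_integral_cong) (auto simp: indicator_def)
    also have "\<dots> = ennreal (LINT x|M. 2 * (a x * indicator A x))"
      using a(2) aint[OF that] by (intro nn_integral_eq_integral) (auto elim!: eventually_mono)
    finally show ?thesis by (simp add: \<alpha>_def)
  qed
  have f_le: "AE x in M. f x \<le> ennreal (2 * a x)"
  proof (rule nonneg_le_AE_if_nn_integral_le[OF f(1)])
    show "(\<lambda>x. ennreal (2 * a x)) \<in> borel_measurable M" using a_integrable by measurable
    have "(\<integral>\<^sup>+x. ennreal (2 * a x) \<partial>M) = (\<integral>\<^sup>+x. ennreal (2 * a x) * indicator (space M) x \<partial>M)"
      by (intro nn_integral_cong) auto
    then show "(\<integral>\<^sup>+x. ennreal (2 * a x) \<partial>M) < \<infinity>" using nna[OF sets.top] by simp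
    show "(\<integral>\<^sup>+x. f x * indicator A x \<partial>M) \<le> (\<integral>\<^sup>+x. ennreal (2 * a x) * indicator A x \<partial>M)" if "A \<in> sets M" for A
      unfolding nn[OF that] nna[OF that] using \<nu>_le[OF that] by (intro ennreal_leI) (simp add: abs_le_iff)
  qed
  show thesis
  proof
    let ?g = "\<lambda>x. enn2real (f x) - a x"
    show "?g \<in> borel_measurable M" using f(1) a_integrable by measurable
    show "AE x in M. \<bar>?g x\<bar> \<le> a x"
      using f_le a(2)
    proof eventually_elim
      case (elim x)
      then have "enn2real (f x) \<le> 2 * a x" by (intro enn2real_leI) auto
      then show ?case using elim enn2real_nonneg[of "f x"] by (auto simp: abs_le_iff)
    qed
    fix A assume A: "A \<in> sets M"
    have "has_bochner_integral M (\<lambda>x. enn2real (f x) * indicator A x) (\<nu> A + \<alpha> A)"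
    proof (rule has_bochner_integral_nn_integral)
      show "(\<lambda>x. enn2real (f x) * indicator A x) \<in> borel_measurable M" using f(1) A by measurable
      have "(\<integral>\<^sup>+x. ennreal (enn2real (f x) * indicator A x) \<partial>M) = (\<integral>\<^sup>+x. f x * indicator A x \<partial>M)"
        using f_le by (intro nn_integral_cong_AE, eventually_elim)
          (auto simp: indicator_def ennreal_enn2real_if top_unique)
      then show "(\<integral>\<^sup>+x. ennreal (enn2real (f x) * indicator A x) \<partial>M) = ennreal (\<nu> A + \<alpha> A)"
        using nn[OF A] by simp
    qed (use \<nu>_le[OF A] in \<open>auto simp: abs_le_iff\<close>)
    from has_bochner_integral_diff[OF this has_bochner_integral_integrable[OF aint[OF A]]]
    have "has_bochner_integral M (\<lambda>x. ?g x * indicator A x) (\<nu> A)"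
      by (simp add: \<alpha>_def left_diff_distrib)
    then show "l (\<lambda>x. indicator A x *\<^sub>R b) = (LINT x|M. ?g x * indicator A x)"
      by (simp add: has_bochner_integral_integral_eq \<nu>_def)
  qed
qed

lemma scaleR_const_L2: 
  assumes "h \<in> L2 \<Omega>" shows "(\<lambda>x. (h x :: real) *\<^sub>R b) \<in> L2 \<Omega>"
proof (rule L2_bound)
  show "(\<lambda>x. norm b *\<^sub>R h x) \<in> L2 \<Omega>" by (rule L2_scaleR[OF assms])
qed (use assms in \<open>auto simp: L2_def abs_mult mult.commute\<close>)

text \<open>
  Extension from indicators to nonnegative functions by monotone approximation: \<open>l\<close> is continuous
  along increasing sequences, because \<open>\<bar>l (h b) - l (U\<^sub>i b)\<bar> \<le> \<integral> a |h - U\<^sub>i|\<close>.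
\<close>

lemma representation_along_direction_nonneg:
  assumes g: "g \<in> L2 \<Omega>" and b: "norm b = 1"
    and rep: "\<And>A. A \<in> sets M \<Longrightarrow> l (\<lambda>x. indicator A x *\<^sub>R b) = (LINT x|M. g x * indicator A x)"
    and h: "h \<in> borel_measurable M" "\<And>x. 0 \<le> h x"
  shows "h \<in> L2 \<Omega> \<longrightarrow> l (\<lambda>x. h x *\<^sub>R b) = (LINT x|M. g x * h x)"
  using h
proof (induction rule: borel_measurable_induct_real)
  case (set A)
  then show ?case using rep by simp
next
  case (mult u c)
  show ?case
  proof
    assume cu: "(\<lambda>x. c * u x) \<in> L2 \<Omega>"
    show "l (\<lambda>x. (c * u x) *\<^sub>R b) = (LINT x|M. g x * (c * u x))"
    proof (cases "c = 0")
      case True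
      then show ?thesis using l_scale[OF L2_const[OF fin, of 0], of 0] by simp
    next
      case False
      have "u \<in> L2 \<Omega>" using L2_scaleR[OF cu, of "inverse c"] False by (simp add: mult.assoc[symmetric])
      then have "l (\<lambda>x. u x *\<^sub>R b) = (LINT x|M. g x * u x)" using mult by simp
      then show ?thesis using l_scale[OF scaleR_const_L2[OF \<open>u \<in> L2 \<Omega>\<close>], of c b]
        by (simp add: mult.left_commute)
    qed
  qed
next
  case (add u v)
  show ?case
  proof
    assume uv: "(\<lambda>x. v x + u x) \<in> L2 \<Omega>"
    have L: "u \<in> L2 \<Omega>" "v \<in> L2 \<Omega>"
      by (rule L2_bound[OF uv]; use add in simp)+
    then have "l (\<lambda>x. v x *\<^sub>R b + u x *\<^sub>R b) = (LINT x|M. g x * v x) + (LINT x|M. g x * u x)"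
      using add by (subst l_add) (auto intro: scaleR_const_L2)
    then show "l (\<lambda>x. (v x + u x) *\<^sub>R b) = (LINT x|M. g x * (v x + u x))"
      using L2_mult_integrable[OF g L(1)] L2_mult_integrable[OF g L(2)]
      by (simp add: scaleR_add_left distrib_left)
  qed
next
  case (seq U)
  show ?case
  proof
    assume hL: "h \<in> L2 \<Omega>"
    have Ule: "U i x \<le> h x" if "x \<in> space M" for i x
      using incseq_le[OF _ seq.hyps(4)[OF that]] seq.hyps(3) by (auto simp: incseq_def le_fun_def)
    have UL: "U i \<in> L2 \<Omega>" for i
      by (rule L2_bound[OF hL seq.hyps(1)]) (use Ule seq.hyps(2) h(2) in \<open>auto intro!: AE_I2\<close>)
    have lim1: "(\<lambda>i. LINT x|M. g x * U i x) \<longlonglongrightarrow> (LINT x|M. g x * h x)"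
    proof (rule integral_dominated_convergence)
      show "integrable M (\<lambda>x. norm (g x) * norm (h x))" by (rule L2_norm_mult_integrable[OF g hL])
      show "AE x in M. norm (g x * U i x) \<le> norm (g x) * norm (h x)" for i
        using Ule seq.hyps(2) h(2) by (auto intro!: AE_I2 mult_left_mono simp: abs_mult)
      have "g \<in> borel_measurable M" "h \<in> borel_measurable M" "U i \<in> borel_measurable M" for i
        using g hL UL by (auto simp: L2_def)
      then show "(\<lambda>x. g x * h x) \<in> borel_measurable M" "(\<lambda>x. g x * U i x) \<in> borel_measurable M" for i
        by (intro borel_measurable_times; simp)+
    qed (use seq.hyps(4) in \<open>auto intro!: AE_I2 tendsto_intros\<close>)
    have lim2: "(\<lambda>i. LINT x|M. a x * norm (h x *\<^sub>R b - U i x *\<^sub>R b)) \<longlonglongrightarrow> (LINT x|M. 0)"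
    proof (rule integral_dominated_convergence)
      show "integrable M (\<lambda>x. norm (a x) * norm (h x))" by (rule L2_norm_mult_integrable[OF a(1) hL])
      show "AE x in M. norm (a x * norm (h x *\<^sub>R b - U i x *\<^sub>R b)) \<le> norm (a x) * norm (h x)" for i
        using Ule seq.hyps(2) h(2) b
        by (auto intro!: AE_I2 mult_left_mono simp: abs_mult scaleR_diff_left[symmetric])
      show "AE x in M. (\<lambda>i. a x * norm (h x *\<^sub>R b - U i x *\<^sub>R b)) \<longlonglongrightarrow> 0"
        using seq.hyps(4) by (intro AE_I2) (auto intro!: tendsto_eq_intros)
      show "(\<lambda>x. a x * norm (h x *\<^sub>R b - U i x *\<^sub>R b)) \<in> borel_measurable M" for i
        using a_mult_integrable[OF L2_lincomb[OF scaleR_const_L2[OF hL, of b] scaleR_const_L2[OF UL, where b = b], of 1 "-1"]]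
        by (simp add: borel_measurable_integrable)
    qed simp
    have "(\<lambda>i. l (\<lambda>x. h x *\<^sub>R b) - l (\<lambda>x. U i x *\<^sub>R b)) \<longlonglongrightarrow> 0"
    proof (rule Lim_null_comparison)
      show "\<forall>\<^sub>F i in sequentially. norm (l (\<lambda>x. h x *\<^sub>R b) - l (\<lambda>x. U i x *\<^sub>R b))
          \<le> (LINT x|M. a x * norm (h x *\<^sub>R b - U i x *\<^sub>R b))"
        using l_abs_le[OF L2_lincomb[OF scaleR_const_L2[OF hL, of b] scaleR_const_L2[OF UL, where b = b], of 1 "-1"]]
        by (intro always_eventually allI)
          (simp add: l_diff[OF scaleR_const_L2[OF hL] scaleR_const_L2[OF UL], symmetric])
    qed (use lim2 in simp)
    then have "(\<lambda>i. l (\<lambda>x. U i x *\<^sub>R b)) \<longlonglongrightarrow> l (\<lambda>x. h x *\<^sub>R b)"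
      using tendsto_diff[OF tendsto_const, of _ 0 sequentially "l (\<lambda>x. h x *\<^sub>R b)"] by fastforce
    moreover have "l (\<lambda>x. U i x *\<^sub>R b) = (LINT x|M. g x * U i x)" for i using seq.IH UL by blast
    ultimately show "l (\<lambda>x. h x *\<^sub>R b) = (LINT x|M. g x * h x)"
      using lim1 by (auto intro: LIMSEQ_unique)
  qed
qed

lemma representation_along_direction:
  assumes g: "g \<in> L2 \<Omega>" and b: "norm b = 1"
    and rep: "\<And>A. A \<in> sets M \<Longrightarrow> l (\<lambda>x. indicator A x *\<^sub>R b) = (LINT x|M. g x * indicator A x)"
    and h: "h \<in> L2 \<Omega>"
  shows "l (\<lambda>x. h x *\<^sub>R b) = (LINT x|M. g x * h x)"
proof -
  let ?p = "\<lambda>x. max (h x) 0" and ?n = "\<lambda>x. max (- h x) 0"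
  have L: "?p \<in> L2 \<Omega>" "?n \<in> L2 \<Omega>"
    by (rule L2_bound[OF h]; use h in \<open>auto simp: L2_def\<close>)+
  have rp: "l (\<lambda>x. ?p x *\<^sub>R b) = (LINT x|M. g x * ?p x)"
    and rn: "l (\<lambda>x. ?n x *\<^sub>R b) = (LINT x|M. g x * ?n x)"
    using representation_along_direction_nonneg[OF g b rep, of ?p]
      representation_along_direction_nonneg[OF g b rep, of ?n] L by (auto simp: L2_def)
  have eq: "h x = ?p x - ?n x" for x by simp
  have "l (\<lambda>x. h x *\<^sub>R b) = l (\<lambda>x. ?p x *\<^sub>R b - ?n x *\<^sub>R b)"
    by (subst eq) (simp only: scaleR_diff_left)
  also have "\<dots> = (LINT x|M. g x * ?p x) - (LINT x|M. g x * ?n x)"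
    unfolding l_diff[OF scaleR_const_L2[OF L(1)] scaleR_const_L2[OF L(2)]] rp rn ..
  also have "\<dots> = (LINT x|M. g x * ?p x - g x * ?n x)"
    using L2_mult_integrable[OF g L(1)] L2_mult_integrable[OF g L(2)] by simp
  also have "\<dots> = (LINT x|M. g x * h x)"
    by (intro Bochner_Integration.integral_cong refl) (auto simp: max_def)
  finally show ?thesis .
qed

lemma L2_sum: "finite I \<Longrightarrow> (\<And>i. i \<in> I \<Longrightarrow> f i \<in> L2 \<Omega>) \<Longrightarrow> (\<lambda>x. \<Sum>i\<in>I. f i x) \<in> L2 \<Omega>"
  by (induction I rule: finite_induct) (auto intro: L2_const[OF fin] L2_add)

lemma l_sum: "finite I \<Longrightarrow> (\<And>i. i \<in> I \<Longrightarrow> f i \<in> L2 \<Omega>) \<Longrightarrow> l (\<lambda>x. \<Sum>i\<in>I. f i x) = (\<Sum>i\<in>I. l (f i))"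
proof (induction I rule: finite_induct)
  case empty
  then show ?case using l_scale[OF L2_const[OF fin, of 0], of 0] by simp
next
  case (insert i I)
  then show ?case using l_add[OF _ L2_sum[of I f], of "f i"] by simp
qed

text \<open>
  The component densities only give \<open>|N|\<close> at most a multiple of \<open>a\<close>. The sharp bound follows by testing
  with the direction \<open>N / |N|\<close> on the set where \<open>|N| > a\<close>.
\<close>

lemma representing_field_bound:
  assumes N: "N \<in> L2 \<Omega>" and rep: "\<And>f. f \<in> L2 \<Omega> \<Longrightarrow> l f = (LINT x|M. N x \<bullet> f x)"
  shows "AE x in M. norm (N x) \<le> a x"
proof -
  define E where "E = {x \<in> space M. a x < norm (N x)}"
  have mN: "N \<in> borel_measurable M" and ma: "a \<in> borel_measurable M" using N a(1) by (auto simp: L2_def)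
  have E: "E \<in> sets M" unfolding E_def using mN ma by measurable
  define f where "f x = (indicator E x / norm (N x)) *\<^sub>R N x" for x
  have f: "f \<in> L2 \<Omega>"
  proof (rule L2_bound[OF L2_const[OF fin, of "1::real"]])
    show "f \<in> borel_measurable M" unfolding f_def using mN E by measurable
    show "AE x in M. norm (f x) \<le> norm (1::real)" by (intro AE_I2) (auto simp: f_def indicator_def)
  qed
  have int: "integrable M (\<lambda>x. N x \<bullet> f x)" "integrable M (\<lambda>x. a x * norm (f x))"
    by (rule L2_inner_integrable[OF N f], rule a_mult_integrable[OF f])
  have eq: "AE x in M. N x \<bullet> f x - a x * norm (f x) = indicator E x * (norm (N x) - a x)"
    using a(2)
  proof eventually_elim
    case (elim x)
    show ?case
    proof (cases "x \<in> E")
      case True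
      then have "N x \<noteq> 0" using elim by (auto simp: E_def)
      then show ?thesis using True
        by (simp add: f_def power2_norm_eq_inner[symmetric] power2_eq_square)
    qed (simp add: f_def)
  qed
  have nonneg: "AE x in M. 0 \<le> N x \<bullet> f x - a x * norm (f x)"
    using eq by eventually_elim (auto simp: E_def indicator_def)
  have "(LINT x|M. N x \<bullet> f x - a x * norm (f x)) \<le> 0"
    using l_le[OF f] rep[OF f] int by simp
  then have "(LINT x|M. N x \<bullet> f x - a x * norm (f x)) = 0"
    using integral_nonneg_AE[OF nonneg] by simp
  then have "AE x in M. N x \<bullet> f x - a x * norm (f x) = 0"
    using integral_nonneg_eq_0_iff_AE[OF _ nonneg] int by simp
  then show ?thesis using eq AE_space
    by eventually_elim (auto simp: E_def indicator_def split: if_splits)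
qed

text \<open>
  The Riesz representation theorem for functionals dominated by a weighted $L^1$ norm: the densities
  along an orthonormal basis are the components of \<open>N\<close>.
\<close>

lemma representation:
  obtains N where "N \<in> L2 \<Omega>" "AE x in M. norm (N x) \<le> a x"
    "\<And>f. f \<in> L2 \<Omega> \<Longrightarrow> l f = (LINT x|M. N x \<bullet> f x)"
proof -
  have "\<exists>g. g \<in> L2 \<Omega> \<and> (\<forall>h\<in>L2 \<Omega>. l (\<lambda>x. h x *\<^sub>R b) = (LINT x|M. g x * h x))" if "b \<in> Basis" for b
  proof -
    have b: "norm b = 1" using that by simp
    obtain g where g: "g \<in> borel_measurable M" "AE x in M. \<bar>g x\<bar> \<le> a x"
      "\<And>A. A \<in> sets M \<Longrightarrow> l (\<lambda>x. indicator A x *\<^sub>R b) = (LINT x|M. g x * indicator A x)"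
      by (rule density_along_direction[OF b]) blast
    have gL: "g \<in> L2 \<Omega>"
      by (rule L2_bound[OF a(1) g(1)]) (use g(2) in \<open>auto elim!: eventually_mono\<close>)
    show ?thesis using gL representation_along_direction[OF gL b g(3)] by blast
  qed
  then obtain g where g: "\<And>b. b \<in> Basis \<Longrightarrow> g b \<in> L2 \<Omega>"
    and rep: "\<And>b h. b \<in> Basis \<Longrightarrow> h \<in> L2 \<Omega> \<Longrightarrow> l (\<lambda>x. h x *\<^sub>R b) = (LINT x|M. g b x * h x)"
    by metis
  define N where "N x = (\<Sum>b\<in>Basis. g b x *\<^sub>R b)" for x
  have N: "N \<in> L2 \<Omega>"
    unfolding N_def by (intro L2_sum scaleR_const_L2 g) auto
  have repN: "l f = (LINT x|M. N x \<bullet> f x)" if f: "f \<in> L2 \<Omega>" for f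
  proof -
    have comp: "(\<lambda>x. f x \<bullet> b) \<in> L2 \<Omega>" if "b \<in> Basis" for b
      by (rule L2_bound[OF f]) (use f that in \<open>auto simp: L2_def Basis_le_norm intro!: AE_I2\<close>)
    have "l f = l (\<lambda>x. \<Sum>b\<in>Basis. (f x \<bullet> b) *\<^sub>R b)" by (simp add: euclidean_representation)
    also have "\<dots> = (\<Sum>b\<in>Basis. l (\<lambda>x. (f x \<bullet> b) *\<^sub>R b))"
      by (rule l_sum) (auto intro: scaleR_const_L2 comp)
    also have "\<dots> = (\<Sum>b\<in>Basis. (LINT x|M. g b x * (f x \<bullet> b)))"
      by (intro sum.cong refl rep comp)
    also have "\<dots> = (LINT x|M. (\<Sum>b\<in>Basis. g b x * (f x \<bullet> b)))"
      by (intro Bochner_Integration.integral_sum[symmetric] L2_mult_integrable g comp)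
    also have "\<dots> = (LINT x|M. N x \<bullet> f x)"
      by (simp add: N_def inner_sum_left inner_sum_right inner_commute)
    finally show ?thesis .
  qed
  show thesis using that[OF N representing_field_bound[OF N repN] repN] .
qed

end

section \<open>Duality\<close>

text \<open>
  Equality in the Cauchy--Schwarz inequality: \<open>|\<alpha> g / |g| - n|\<^sup>2\<close> expands to \<open>|n|\<^sup>2 - \<alpha>\<^sup>2\<close>, which is at
  most zero.
\<close>

lemma scaleR_unit_eq_if_inner_eq:
  fixes g n :: "'a::real_inner"
  assumes "g \<noteq> 0" and eq: "\<alpha> * norm g = g \<bullet> n" and le: "norm n \<le> \<alpha>"
  shows "\<alpha> *\<^sub>R (g /\<^sub>R norm g) = n"
proof -
  define e where "e = g /\<^sub>R norm g"
  have e: "e \<bullet> e = 1" using assms(1) by (simp add: e_def dot_square_norm power2_eq_square)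
  have en: "e \<bullet> n = \<alpha>" using assms(1) eq by (simp add: e_def field_simps)
  have "(norm (\<alpha> *\<^sub>R e - n))\<^sup>2 = \<alpha>\<^sup>2 - 2 * \<alpha> * \<alpha> + (norm n)\<^sup>2"
    using e en unfolding power2_norm_eq_inner
    by (simp add: inner_diff_left inner_diff_right inner_commute power2_eq_square)
  also have "\<dots> \<le> 0"
    using power_mono[OF le, of 2] by (simp add: power2_eq_square)
  finally show ?thesis by (simp add: e_def)
qed

theorem theorem3p1:
  fixes \<Omega> :: "(real ^ 'n::finite) set"
    and F :: "real ^ 'n \<Rightarrow> real ^ 'n"
    and H a :: "real ^ 'n \<Rightarrow> real"
  assumes "bounded_domain \<Omega>"
    and "F \<in> L2 \<Omega>"
    and "H \<in> L2 \<Omega>"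
    and "a \<in> L2 \<Omega>"
    and "AE x in lebesgue_on \<Omega>. a x > 0"
    and "bdd_below (primal_functional \<Omega> a F H ` H10 \<Omega>)"
  shows "(INF u\<in>H10 \<Omega>. primal_functional \<Omega> a F H u)
           = (SUP b\<in>dual_feasible \<Omega> a H. pairing \<Omega> F b) \<and>
         (\<exists>N. is_arg_max (pairing \<Omega> F) (\<lambda>b. b \<in> dual_feasible \<Omega> a H) N \<and>
              (INF u\<in>H10 \<Omega>. primal_functional \<Omega> a F H u) = pairing \<Omega> F N \<and>
              (\<forall>u. is_arg_min (primal_functional \<Omega> a F H) (\<lambda>v. v \<in> H10 \<Omega>) u \<longrightarrow>
                 (AE x in density (lebesgue_on \<Omega>) (\<lambda>x. ennreal (norm (weak_grad \<Omega> u x + F x))).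
                    a x *\<^sub>R ((weak_grad \<Omega> u x + F x) /\<^sub>R norm (weak_grad \<Omega> u x + F x)) = N x)))"
proof -
  let ?M = "lebesgue_on \<Omega>"
  let ?J = "primal_functional \<Omega> a F H"
  let ?D = "weak_grad \<Omega>"
  have \<Omega>: "open \<Omega>" "bounded \<Omega>" using assms(1) by (auto simp: bounded_domain_def)
  note F = assms(2) and H = assms(3) and a = assms(4)
  have a0: "AE x in ?M. 0 \<le> a x" using assms(5) by eventually_elim simp
  have fin: "finite_measure ?M" by (rule finite_measure_bounded_open[OF \<Omega>])
  interpret X: function_subspace "L2 \<Omega> :: (real ^ 'n \<Rightarrow> real ^ 'n) set"
    by (rule function_subspace_L2[OF fin])
  define m where "m = (INF u\<in>H10 \<Omega>. ?J u)"
  define p where "p f = (LINT x|?M. a x * norm (f x))" for f :: "real ^ 'n \<Rightarrow> real ^ 'n"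
  define h where "h u = (LINT x|?M. H x * u x)" for u
  have DL: "?D u \<in> L2 \<Omega>" if "u \<in> H10 \<Omega>" for u
    by (rule weak_grad_works(1)[OF H10_imp_H1[OF that]])
  have pint: "integrable ?M (\<lambda>x. a x * norm (f x))" if "f \<in> L2 \<Omega>" for f :: "real ^ 'n \<Rightarrow> real ^ 'n"
    by (rule L2_mult_integrable[OF a L2_norm[OF that]])
  have hint: "integrable ?M (\<lambda>x. H x * u x)" if "u \<in> H10 \<Omega>" for u
    by (rule L2_mult_integrable[OF H H10_imp_L2[OF that]])
  have Dlin: "AE x in ?M. ?D (\<lambda>x. c * u x + d * v x) x = c *\<^sub>R ?D u x + d *\<^sub>R ?D v x"
    if "u \<in> H10 \<Omega>" "v \<in> H10 \<Omega>" for u v c d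
    by (rule weak_grad_lincomb[OF \<Omega> that[THEN H10_imp_H1]])
  have hlin: "h (\<lambda>x. c * u x + d * v x) = c * h u + d * h v" if "u \<in> H10 \<Omega>" "v \<in> H10 \<Omega>" for u v c d
  proof -
    have "h (\<lambda>x. c * u x + d * v x) = (LINT x|?M. c * (H x * u x) + d * (H x * v x))"
      unfolding h_def by (intro Bochner_Integration.integral_cong refl) (simp add: algebra_simps)
    also have "\<dots> = c * h u + d * h v" using hint[OF that(1)] hint[OF that(2)] by (simp add: h_def)
    finally show ?thesis .
  qed
  have p_cong: "p f = p g" if "f \<in> L2 \<Omega>" "g \<in> L2 \<Omega>" "AE x in ?M. f x = g x" for f g
    unfolding p_def using that(3) pint[OF that(1)] pint[OF that(2)]
    by (intro integral_cong_AE) (auto elim!: eventually_mono)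
  have J: "?J u = p (\<lambda>x. ?D u x + F x) + h u" if "u \<in> H10 \<Omega>" for u
    unfolding primal_functional_def p_def h_def
    by (rule Bochner_Integration.integral_add[OF pint[OF L2_add[OF DL[OF that] F]] hint[OF that]])
  have m_le: "m \<le> ?J u" if "u \<in> H10 \<Omega>" for u
    unfolding m_def by (rule cINF_lower[OF assms(6) that])
  have p_sub: "X.sublinear p"
    unfolding X.sublinear_def
  proof (intro conjI ballI allI impI)
    fix f g :: "real ^ 'n \<Rightarrow> real ^ 'n" assume fg: "f \<in> L2 \<Omega>" "g \<in> L2 \<Omega>"
    have "p (\<lambda>x. f x + g x) \<le> (LINT x|?M. a x * norm (f x) + a x * norm (g x))"
      unfolding p_def
    proof (rule integral_mono_AE[OF pint[OF L2_add[OF fg]]])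
      show "AE x in ?M. a x * norm (f x + g x) \<le> a x * norm (f x) + a x * norm (g x)"
        using a0 by eventually_elim (simp add: distrib_left[symmetric] mult_left_mono norm_triangle_ineq)
    qed (use pint[OF fg(1)] pint[OF fg(2)] in simp)
    then show "p (\<lambda>x. f x + g x) \<le> p f + p g" using pint[OF fg(1)] pint[OF fg(2)] by (simp add: p_def)
  next
    fix f :: "real ^ 'n \<Rightarrow> real ^ 'n" and c :: real assume "f \<in> L2 \<Omega>" "0 \<le> c"
    then show "p (\<lambda>x. c *\<^sub>R f x) = c * p f" by (simp add: p_def mult.left_commute)
  qed
  \<comment> \<open>Homogeneity: this is \<open>s\<close> times \<open>m \<le> J (u / s)\<close>.\<close>
  have scaled: "s * m \<le> p (\<lambda>x. ?D u x + s *\<^sub>R F x) + h u" if u: "u \<in> H10 \<Omega>" and s: "s > 0" for u s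
  proof -
    let ?v = "\<lambda>x. inverse s * u x + 0 * u x"
    have v: "?v \<in> H10 \<Omega>" by (rule H10_lincomb[OF \<Omega> u u])
    have "s * m \<le> s * ?J ?v" using m_le[OF v] s by simp
    also have "s * ?J ?v = p (\<lambda>x. s *\<^sub>R (?D ?v x + F x)) + s * h ?v"
      unfolding J[OF v] using X.sublinear_scale[OF p_sub L2_add[OF DL[OF v] F], of s] s by (simp add: distrib_left)
    also have "s * h ?v = h u" using hlin[OF u u, of "inverse s" 0] s by simp
    also have "p (\<lambda>x. s *\<^sub>R (?D ?v x + F x)) = p (\<lambda>x. ?D u x + s *\<^sub>R F x)"
    proof (rule p_cong)
      show "AE x in ?M. s *\<^sub>R (?D ?v x + F x) = ?D u x + s *\<^sub>R F x"
        using Dlin[OF u u, of "inverse s" 0] by eventually_elim (use s in \<open>simp add: scaleR_add_right\<close>)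
    qed (intro L2_scaleR L2_add DL v u F)+
    finally show ?thesis .
  qed
  \<comment> \<open>The recession inequality is the limit of the previous one as \<open>s\<close> tends to zero.\<close>
  have "0 * m \<le> (p (?D u) + h u) + 0 * p F" if u: "u \<in> H10 \<Omega>" for u
  proof (rule tendsto_le[OF sequentially_bot])
    show "(\<lambda>k. (p (?D u) + h u) + inverse (real (Suc k)) * p F) \<longlonglongrightarrow> (p (?D u) + h u) + 0 * p F"
      by (intro tendsto_intros LIMSEQ_inverse_real_of_nat)
    show "(\<lambda>k. inverse (real (Suc k)) * m) \<longlonglongrightarrow> 0 * m"
      by (intro tendsto_intros LIMSEQ_inverse_real_of_nat)
    show "\<forall>\<^sub>F k in sequentially. inverse (real (Suc k)) * m \<le> (p (?D u) + h u) + inverse (real (Suc k)) * p F"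
    proof (intro always_eventually allI)
      fix k
      let ?s = "inverse (real (Suc k))"
      have "?s * m \<le> p (\<lambda>x. ?D u x + ?s *\<^sub>R F x) + h u" by (rule scaled[OF u]) simp
      also have "p (\<lambda>x. ?D u x + ?s *\<^sub>R F x) \<le> p (?D u) + p (\<lambda>x. ?s *\<^sub>R F x)"
        by (rule X.sublinear_add[OF p_sub DL[OF u] L2_scaleR[OF F]])
      also have "p (\<lambda>x. ?s *\<^sub>R F x) = ?s * p F" by (rule X.sublinear_scale[OF p_sub F]) simp
      finally show "?s * m \<le> (p (?D u) + h u) + ?s * p F" by simp
    qed
  qed
  then have recession: "0 \<le> p (?D u) + h u" if "u \<in> H10 \<Omega>" for u using that by simp
  \<comment> \<open>The demands on \<open>l\<close>. Almost everywhere equality makes this a cone, as \<open>weak_grad\<close> is only linear up to null sets.\<close>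
  define C where "C = {(G, b). G \<in> L2 \<Omega> \<and> (\<exists>u\<in>H10 \<Omega>. \<exists>s\<ge>0.
      (AE x in ?M. G x = ?D u x + s *\<^sub>R F x) \<and> b = s * m - h u)}"
  have C: "X.convex_cone C"
    unfolding X.convex_cone_def
  proof (intro conjI allI impI)
    show "C \<subseteq> L2 \<Omega> \<times> UNIV" by (auto simp: C_def)
    have z: "(\<lambda>x. 0) \<in> H10 \<Omega>" by (rule zero_in_H10[OF \<Omega>])
    have "AE x in ?M. ?D (\<lambda>x. 0) x = 0" using Dlin[OF z z, of 0 0] by simp
    moreover have "h (\<lambda>x. 0) = 0" by (simp add: h_def)
    ultimately show "((\<lambda>x. 0), 0) \<in> C"
      using X.zero z by (auto simp: C_def intro!: bexI[OF _ z] exI[of _ 0] elim!: eventually_mono)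
  next
    fix f b g c assume "(f, b) \<in> C" "(g, c) \<in> C"
    then obtain u s v t where u: "f \<in> L2 \<Omega>" "u \<in> H10 \<Omega>" "0 \<le> s" "AE x in ?M. f x = ?D u x + s *\<^sub>R F x" "b = s * m - h u"
      and v: "g \<in> L2 \<Omega>" "v \<in> H10 \<Omega>" "0 \<le> t" "AE x in ?M. g x = ?D v x + t *\<^sub>R F x" "c = t * m - h v"
      unfolding C_def by blast
    let ?w = "\<lambda>x. 1 * u x + 1 * v x"
    have w: "?w \<in> H10 \<Omega>" by (rule H10_lincomb[OF \<Omega> u(2) v(2)])
    have "AE x in ?M. f x + g x = ?D ?w x + (s + t) *\<^sub>R F x"
      using u(4) v(4) Dlin[OF u(2) v(2), of 1 1] by eventually_elim (simp add: algebra_simps)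
    moreover have "b + c = (s + t) * m - h ?w"
      using hlin[OF u(2) v(2), of 1 1] u(5) v(5) by (simp add: algebra_simps)
    moreover have "0 \<le> s + t" using u(3) v(3) by simp
    ultimately show "((\<lambda>x. f x + g x), b + c) \<in> C"
      using w L2_add[OF u(1) v(1)] unfolding C_def by blast
  next
    fix f b and r :: real assume "(f, b) \<in> C" and r: "0 < r"
    then obtain u s where u: "f \<in> L2 \<Omega>" "u \<in> H10 \<Omega>" "0 \<le> s" "AE x in ?M. f x = ?D u x + s *\<^sub>R F x" "b = s * m - h u"
      unfolding C_def by blast
    let ?w = "\<lambda>x. r * u x + 0 * u x"
    have w: "?w \<in> H10 \<Omega>" by (rule H10_lincomb[OF \<Omega> u(2) u(2)])
    have "AE x in ?M. r *\<^sub>R f x = ?D ?w x + (r * s) *\<^sub>R F x"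
      using u(4) Dlin[OF u(2) u(2), of r 0] by eventually_elim (simp add: algebra_simps)
    moreover have "r * b = (r * s) * m - h ?w"
      using hlin[OF u(2) u(2), of r 0] by (simp add: u(5) right_diff_distrib)
    moreover have "0 \<le> r * s" using u(3) r by simp
    ultimately show "((\<lambda>x. r *\<^sub>R f x), r * b) \<in> C"
      using w L2_scaleR[OF u(1), of r] unfolding C_def by blast
  qed
  have C_le: "b \<le> p G" if "(G, b) \<in> C" for G b
  proof -
    obtain u s where u: "G \<in> L2 \<Omega>" "u \<in> H10 \<Omega>" "0 \<le> s" "AE x in ?M. G x = ?D u x + s *\<^sub>R F x" "b = s * m - h u"
      using \<open>(G, b) \<in> C\<close> unfolding C_def by blast
    have pG: "p G = p (\<lambda>x. ?D u x + s *\<^sub>R F x)"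
      by (rule p_cong[OF u(1) L2_add[OF DL[OF u(2)] L2_scaleR[OF F]] u(4)])
    show ?thesis
    proof (cases "s = 0")
      case True
      then show ?thesis using recession[OF u(2)] pG u(5) by simp
    next
      case False
      then show ?thesis using scaled[OF u(2), of s] u(3,5) pG by simp
    qed
  qed
  obtain l where l: "X.linear_functional l" "\<And>f. f \<in> L2 \<Omega> \<Longrightarrow> l f \<le> p f" "\<And>G b. (G, b) \<in> C \<Longrightarrow> b \<le> l G"
    by (rule X.Hahn_Banach_cone[OF p_sub C C_le]) blast+
  interpret L: dominated_L2_functional \<Omega> a l
    by (rule dominated_L2_functional.intro[OF fin a a0])
      (use l(1) l(2)[unfolded p_def] in \<open>simp_all add: X.linear_functional_def\<close>)
  obtain N where N: "N \<in> L2 \<Omega>" "AE x in ?M. norm (N x) \<le> a x" "\<And>f. f \<in> L2 \<Omega> \<Longrightarrow> l f = (LINT x|?M. N x \<bullet> f x)"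
    by (rule L.representation) blast
  \<comment> \<open>The demands for \<open>u\<close> and \<open>- u\<close> with \<open>s = 0\<close> combine to an equality.\<close>
  have l_grad: "l (?D u) = - h u" if u: "u \<in> H10 \<Omega>" for u
  proof -
    have ge: "- h u \<le> l (?D u)" if "u \<in> H10 \<Omega>" for u
      using that DL[OF that] by (intro l(3)) (auto simp: C_def intro!: bexI[OF _ that] exI[of _ 0])
    let ?w = "\<lambda>x. (-1) * u x + 0 * u x"
    have w: "?w \<in> H10 \<Omega>" by (rule H10_lincomb[OF \<Omega> u u])
    have "((\<lambda>x. (-1) *\<^sub>R ?D u x), h u) \<in> C"
      unfolding C_def using w L2_scaleR[OF DL[OF u], of "-1"] Dlin[OF u u, of "-1" 0] hlin[OF u u, of "-1" 0]
      by (auto intro!: bexI[OF _ w] exI[of _ 0] elim!: eventually_mono)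
    then have "h u \<le> l (\<lambda>x. (-1) *\<^sub>R ?D u x)" by (rule l(3))
    also have "\<dots> = - l (?D u)" using L.l_scale[OF DL[OF u], of "-1"] by simp
    finally show ?thesis using ge[OF u] by simp
  qed
  have H10_ne: "H10 \<Omega> \<noteq> {}" using zero_in_H10[OF \<Omega>] by blast
  have lF: "l F = m"
  proof (rule antisym)
    have "l F \<le> ?J u" if u: "u \<in> H10 \<Omega>" for u
    proof -
      have "l F = l (\<lambda>x. ?D u x + F x) + h u" using L.l_add[OF DL[OF u] F] l_grad[OF u] by simp
      also have "\<dots> \<le> ?J u" unfolding J[OF u] using l(2)[OF L2_add[OF DL[OF u] F]] by simp
      finally show ?thesis .
    qed
    then show "l F \<le> m" unfolding m_def by (intro cINF_greatest[OF H10_ne])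
    have z: "(\<lambda>x. 0) \<in> H10 \<Omega>" by (rule zero_in_H10[OF \<Omega>])
    have "AE x in ?M. ?D (\<lambda>x. 0) x = 0" using Dlin[OF z z, of 0 0] by simp
    \<comment> \<open>The lower bound is the demand for \<open>u = 0\<close> and \<open>s = 1\<close>.\<close>
    then have "(F, m) \<in> C"
      unfolding C_def using F by (auto simp: h_def intro!: bexI[OF _ z] exI[of _ 1] elim!: eventually_mono)
    then show "m \<le> l F" by (rule l(3))
  qed
  have feas_int: "integrable ?M (\<lambda>x. ?D u x \<bullet> b x)" if "u \<in> H10 \<Omega>" "b \<in> L2 \<Omega>" for u b
    by (rule L2_inner_integrable[OF DL[OF that(1)] that(2)])
  have D0_iff: "b \<in> D0 \<Omega> H \<longleftrightarrow> b \<in> L2 \<Omega> \<and> (\<forall>u\<in>H10 \<Omega>. (LINT x|?M. ?D u x \<bullet> b x) = - h u)" for b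
    unfolding D0_def using feas_int hint by (auto simp: h_def eq_neg_iff_add_eq_0)
  have N_feas: "N \<in> dual_feasible \<Omega> a H"
    unfolding dual_feasible_def D0_iff using N l_grad DL by (simp add: inner_commute)
  have FN: "pairing \<Omega> F N = m" using lF N(3)[OF F] by (simp add: pairing_def inner_commute)
  have split: "?J u - pairing \<Omega> F b = (LINT x|?M. a x * norm (?D u x + F x) - (?D u x + F x) \<bullet> b x)"
    if u: "u \<in> H10 \<Omega>" and b: "b \<in> dual_feasible \<Omega> a H" for u b
  proof -
    have bL: "b \<in> L2 \<Omega>" and b0: "(LINT x|?M. ?D u x \<bullet> b x) = - h u"
      using b u unfolding dual_feasible_def D0_iff by auto
    have "(LINT x|?M. a x * norm (?D u x + F x) - (?D u x + F x) \<bullet> b x)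
      = p (\<lambda>x. ?D u x + F x) - (LINT x|?M. ?D u x \<bullet> b x + F x \<bullet> b x)"
      unfolding p_def using pint[OF L2_add[OF DL[OF u] F]] L2_inner_integrable[OF L2_add[OF DL[OF u] F] bL]
      by (simp add: inner_add_left)
    also have "\<dots> = ?J u - pairing \<Omega> F b"
      unfolding J[OF u] pairing_def using b0 feas_int[OF u bL] L2_inner_integrable[OF F bL] by simp
    finally show ?thesis ..
  qed
  have gap_nonneg: "AE x in ?M. 0 \<le> a x * norm (G x) - G x \<bullet> b x"
    if b: "b \<in> dual_feasible \<Omega> a H" for b and G :: "real ^ 'n \<Rightarrow> real ^ 'n"
  proof -
    have "AE x in ?M. norm (b x) \<le> a x" using b by (simp add: dual_feasible_def)
    then show ?thesis
    proof eventually_elim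
      case (elim x)
      have "G x \<bullet> b x \<le> norm (G x) * norm (b x)" by (rule norm_cauchy_schwarz)
      also have "\<dots> \<le> norm (G x) * a x" using elim by (intro mult_left_mono) auto
      finally show ?case by (simp add: mult.commute)
    qed
  qed
  have weak_duality: "pairing \<Omega> F b \<le> m" if b: "b \<in> dual_feasible \<Omega> a H" for b
    unfolding m_def
  proof (rule cINF_greatest[OF H10_ne])
    fix u assume u: "u \<in> H10 \<Omega>"
    show "pairing \<Omega> F b \<le> ?J u"
      using integral_nonneg_AE[OF gap_nonneg[OF b, of "\<lambda>x. ?D u x + F x"]] split[OF u b] by simp
  qed
  have sup: "(SUP b\<in>dual_feasible \<Omega> a H. pairing \<Omega> F b) = m"
    by (rule cSup_eq_maximum) (use FN N_feas weak_duality in auto)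
  have arg_max: "is_arg_max (pairing \<Omega> F) (\<lambda>b. b \<in> dual_feasible \<Omega> a H) N"
    using N_feas weak_duality FN by (auto simp: is_arg_max_def not_less)
  \<comment> \<open>A minimizer turns the nonnegative integrand of \<open>split\<close> into zero almost everywhere.\<close>
  have extremal: "AE x in density ?M (\<lambda>x. ennreal (norm (?D u x + F x))).
      a x *\<^sub>R ((?D u x + F x) /\<^sub>R norm (?D u x + F x)) = N x"
    if min: "is_arg_min ?J (\<lambda>v. v \<in> H10 \<Omega>) u" for u
  proof -
    let ?G = "\<lambda>x. ?D u x + F x"
    have u: "u \<in> H10 \<Omega>" using min by (simp add: is_arg_min_def)
    have "?J u \<le> ?J v" if "v \<in> H10 \<Omega>" for v using min that by (auto simp: is_arg_min_def not_less)
    then have "?J u \<le> m" unfolding m_def by (rule cINF_greatest[OF H10_ne])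
    then have "?J u = m" using m_le[OF u] by simp
    then have zero: "(LINT x|?M. a x * norm (?G x) - ?G x \<bullet> N x) = 0"
      using split[OF u N_feas] FN by simp
    have G: "?G \<in> L2 \<Omega>" by (rule L2_add[OF DL[OF u] F])
    have "AE x in ?M. a x * norm (?G x) - ?G x \<bullet> N x = 0"
      using zero integral_nonneg_eq_0_iff_AE[OF _ gap_nonneg[OF N_feas, of ?G]]
        pint[OF G] L2_inner_integrable[OF G N(1)] by simp
    then have "AE x in ?M. ?G x \<noteq> 0 \<longrightarrow> a x *\<^sub>R (?G x /\<^sub>R norm (?G x)) = N x"
      using N(2)
    proof eventually_elim
      case (elim x)
      show ?case
        using elim scaleR_unit_eq_if_inner_eq[of "?G x" "a x" "N x"] by simp
    qed
    moreover have "(\<lambda>x. ennreal (norm (?G x))) \<in> borel_measurable ?M" using G by (auto simp: L2_def)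
    ultimately show ?thesis by (subst AE_density) (auto elim!: eventually_mono)
  qed
  show ?thesis
    unfolding m_def[symmetric]
    by (intro conjI exI[of _ N] allI impI sup[symmetric] arg_max FN[symmetric] extremal)
qed

end
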